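(* Let $n$ be an odd positive integer and let $D\subset\mathbb R^n$ be a bounded domain with $C^\infty$ boundary. Suppose that for almost all $\omega\in S^{n-1}$ (with respect to the surface measure) there is a real polynomial $P_\omega$ of degree at most $n-1$ such that $V_D(\omega,t)=P_\omega(t)$ for all $t\in\mathbb R$ such that the hyperplane $\{x\in\mathbb R^n:\langle\omega,x\rangle=t\}$ intersects $D$. Then $D$ is an ellipsoid.
   Context: A domain is a nonempty connected open set. For a bounded domain $D\subset\mathbb R^n$, $\omega\in S^{n-1}$ and $t\in\mathbb R$, the section-volume function $V_D(\omega,t)$ is the $(n-1)$-dimensional volume of $D\cap\{x\in\mathbb R^n:\langle\omega,x\rangle=t\}$, i.e. the Radon transform of the characteristic function $\chi_D$. An ellipsoid here means a solid (open) ellipsoid, i.e. the image of the open unit ball under an invertible affine map of $\mathbb R^n$. *)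

theory Defs
  imports "HOL-Analysis.Analysis" "HOL-Computational_Algebra.Polynomial"
begin

definition bounded_domain :: "'a::euclidean_space set \<Rightarrow> bool" where
  "bounded_domain D \<longleftrightarrow> D \<noteq> {} \<and> open D \<and> connected D \<and> bounded D"


primrec Ck_on :: "nat \<Rightarrow> 'a::euclidean_space set \<Rightarrow> ('a \<Rightarrow> real) \<Rightarrow> bool" where
  "Ck_on 0 U f \<longleftrightarrow> continuous_on U f"
| "Ck_on (Suc k) U f \<longleftrightarrow> (\<forall>x\<in>U. f differentiable (at x)) \<and>
     (\<forall>v. Ck_on k U (\<lambda>x. frechet_derivative f (at x) v))"

definition C_infinity_on :: "'a::euclidean_space set \<Rightarrow> ('a \<Rightarrow> real) \<Rightarrow> bool" where
  "C_infinity_on U f \<longleftrightarrow> (\<forall>k. Ck_on k U f)"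

text \<open>Local defining functions. As the differential of \<open>\<rho>\<close> does not vanish on \<open>U\<close>,
  the frontier of \<open>D\<close> inside \<open>U\<close> is the smooth hypersurface \<open>\<rho> = 0\<close>, and \<open>D\<close> lies
  locally on one side of it.\<close>

definition C_infinity_boundary :: "'a::euclidean_space set \<Rightarrow> bool" where
  "C_infinity_boundary D \<longleftrightarrow>
     (\<forall>p\<in>frontier D. \<exists>U \<rho>. open U \<and> p \<in> U \<and> C_infinity_on U \<rho> \<and>
        (\<forall>x\<in>U. frechet_derivative \<rho> (at x) \<noteq> (\<lambda>_. 0)) \<and>
        D \<inter> U = {x\<in>U. \<rho> x < 0})"


definition hyperplane :: "'a::euclidean_space \<Rightarrow> real \<Rightarrow> 'a set" where
  "hyperplane \<omega> t = {x. \<omega> \<bullet> x = t}"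

definition orthonormal_basis_of :: "'a::euclidean_space set \<Rightarrow> 'a set \<Rightarrow> bool" where
  "orthonormal_basis_of S B \<longleftrightarrow>
     B \<subseteq> S \<and> pairwise orthogonal B \<and> (\<forall>b\<in>B. norm b = 1) \<and> span B = S"

definition hyperplane_basis :: "'a::euclidean_space \<Rightarrow> 'a set" where
  "hyperplane_basis \<omega> = (SOME B. orthonormal_basis_of (hyperplane \<omega> 0) B)"

lemma orthonormal_basis_of_hyperplane_basis:
  "orthonormal_basis_of (hyperplane \<omega> 0) (hyperplane_basis \<omega>)"
proof -
  have "subspace (hyperplane \<omega> 0)"
    by (simp add: hyperplane_def subspace_hyperplane)
  then obtain B where "B \<subseteq> hyperplane \<omega> 0" "pairwise orthogonal B"
    "\<And>x. x \<in> B \<Longrightarrow> norm x = 1" "span B = hyperplane \<omega> 0"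
    using orthonormal_basis_subspace by metis
  then have "\<exists>B. orthonormal_basis_of (hyperplane \<omega> 0) B"
    unfolding orthonormal_basis_of_def by blast
  then show ?thesis
    unfolding hyperplane_basis_def by (rule someI_ex)
qed

text \<open>For a unit vector \<open>\<omega>\<close>: the \<open>(n - 1)\<close>-dimensional Lebesgue measure of the hyperplane
  \<open>\<omega> \<bullet> x = t\<close>, as a Borel measure on the ambient space. It is the image of the product
  Lebesgue measure under orthonormal coordinates, as in the definition of \<open>lborel\<close>, and hence
  independent of the chosen orthonormal basis. If \<open>n = 1\<close>, the basis is empty and the measure is
  the point mass at \<open>t *\<^sub>R \<omega>\<close>.\<close>

definition hyperplane_lborel :: "'a::euclidean_space \<Rightarrow> real \<Rightarrow> 'a measure" where
  "hyperplane_lborel \<omega> t =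
     distr (\<Pi>\<^sub>M b\<in>hyperplane_basis \<omega>. (lborel :: real measure)) borel
       (\<lambda>c. t *\<^sub>R \<omega> + (\<Sum>b\<in>hyperplane_basis \<omega>. c b *\<^sub>R b))"

lemma emeasure_hyperplane_lborel:
  fixes A :: "'a::euclidean_space set"
  assumes "A \<in> sets borel"
  shows "emeasure (hyperplane_lborel \<omega> t) A =
    emeasure (\<Pi>\<^sub>M b\<in>hyperplane_basis \<omega>. (lborel :: real measure))
      {c \<in> hyperplane_basis \<omega> \<rightarrow>\<^sub>E UNIV. t *\<^sub>R \<omega> + (\<Sum>b\<in>hyperplane_basis \<omega>. c b *\<^sub>R b) \<in> A}"
proof -
  have "(\<lambda>c. t *\<^sub>R \<omega> + (\<Sum>b\<in>hyperplane_basis \<omega>. c b *\<^sub>R b)) \<in>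
      (\<Pi>\<^sub>M b\<in>hyperplane_basis \<omega>. (lborel :: real measure)) \<rightarrow>\<^sub>M (borel :: 'a measure)"
    by measurable
  from emeasure_distr[OF this assms] show ?thesis
    unfolding hyperplane_lborel_def
    by (simp add: space_PiM vimage_def Int_def conj_commute)
qed

definition section_volume :: "'a::euclidean_space set \<Rightarrow> 'a \<Rightarrow> real \<Rightarrow> real" where
  "section_volume D \<omega> t = measure (hyperplane_lborel \<omega> t) (D \<inter> hyperplane \<omega> t)"


text \<open>The surface measure of a Borel set \<open>A\<close> of unit vectors is \<open>n\<close> times the volume of the
  cone over \<open>A\<close> in the unit ball (polar coordinates).\<close>

definition sphere_measure :: "'a::euclidean_space measure" where
  "sphere_measure = scale_measure (of_nat DIM('a))
     (distr (restrict_space lborel (ball 0 1 - {0})) (restrict_space borel (sphere 0 1))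
       (\<lambda>x. x /\<^sub>R norm x))"

lemma space_sphere_measure: "space sphere_measure = sphere 0 1"
  by (simp add: sphere_measure_def space_scale_measure space_restrict_space)

lemma sets_sphere_measure: "sets sphere_measure = sets (restrict_space borel (sphere 0 1))"
  by (simp add: sphere_measure_def)

lemma emeasure_sphere_measure:
  fixes A :: "'a::euclidean_space set"
  assumes "A \<in> sets borel" "A \<subseteq> sphere 0 1"
  shows "emeasure sphere_measure A =
    of_nat DIM('a) * emeasure lborel {x \<in> ball 0 1 - {0}. x /\<^sub>R norm x \<in> A}"
proof -
  have ne: "x \<noteq> 0" if "x \<in> ball 0 1 - {0}" for x :: 'a using that by simp
  have meas: "(\<lambda>x::'a. x /\<^sub>R norm x) \<in>
      restrict_space lborel (ball 0 1 - {0}) \<rightarrow>\<^sub>M restrict_space borel (sphere 0 1)"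
    by (rule measurable_restrict_space2)
      (auto simp: space_restrict_space intro!: measurable_restrict_space1)
  have A: "A \<in> sets (restrict_space borel (sphere 0 1))"
    using assms by (auto simp: sets_restrict_space)
  have "(\<lambda>x::'a. x /\<^sub>R norm x) -` A \<inter> space (restrict_space lborel (ball 0 1 - {0}))
      = {x \<in> ball 0 1 - {0}. x /\<^sub>R norm x \<in> A}"
    by (auto simp: space_restrict_space)
  then show ?thesis
    unfolding sphere_measure_def
    by (simp add: emeasure_distr[OF meas A] emeasure_restrict_space subset_iff)
qed


definition ellipsoid :: "'a::euclidean_space set \<Rightarrow> bool" where
  "ellipsoid E \<longleftrightarrow> (\<exists>(f :: 'a \<Rightarrow> 'a) c. linear f \<and> bij f \<and> E = (\<lambda>x. f x + c) ` ball 0 1)"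

end

theory Submission
  imports Defs
begin

text \<open>Let \<open>n = 2 * m + 1\<close>. The caps of \<open>D\<close> of height \<open>s\<close> have volume \<open>o(s ^ m)\<close> for almost
  all directions, along a sequence of heights \<open>s\<close>: this follows by averaging over the directions,
  because \<open>D\<close> is a union of balls of a fixed radius. Hence the section polynomial vanishes to order
  \<open>m\<close> at both ends of its interval. Its degree is at most \<open>2 * m\<close>, so it is a multiple of
  \<open>(h\<^sup>2 - (t - c)\<^sup>2) ^ m\<close>, where \<open>c\<close> and \<open>h\<close> are the centre and the half-width of the interval. The first
  two moments of \<open>D\<close> show that \<open>c\<close> is a linear and \<open>h\<^sup>2\<close> a quadratic form in the direction, as they are
  for an ellipsoid. The same formula for the unit ball shows that \<open>D\<close> and this ellipsoid have
  proportional integrals of all exponentials, hence of all continuous functions, and since \<open>D\<close>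
  lies locally on one side of its boundary the two sets coincide.\<close>

section \<open>Slicing by hyperplanes\<close>

text \<open>In a single direction nothing bounds the decay of the caps: the boundary may be flat at
  the extreme point, with caps of volume comparable to s, and \<open>D\<close> is not known to be
  convex. What can be controlled is, for a fixed \<open>x\<close> in \<open>D\<close>, the set of
  directions whose cap of height s contains \<open>x\<close>: a ball of radius R in \<open>D\<close>
  containing \<open>x\<close> pins them to within O(sqrt (s/R)) of an axis, a set of measure
  O(s^((n-1)/2)) = O(s^m). Tonelli turns this into a bound on the mean cap volume, dominated
  convergence improves O to o because \<open>x\<close> leaves all small caps, and Fatou returns to
  almost every direction. This gain matters: a zero of order j gives caps of order s^(j+1), so
  O(s^m) would still allow j = m - 1. Directions are replaced by vectors with 1/2 < |y| < 1, so that
  null sets refer to Lebesgue measure and lengths stay away from 0. Exponentials are the test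
  functions because they separate points, their products are exponentials, and a translation only
  contributes a factor.\<close>

lemma nn_integral_lborel_shift:
  fixes f :: "'a::euclidean_space \<Rightarrow> ennreal"
  assumes [measurable]: "f \<in> borel_measurable borel"
  shows "(\<integral>\<^sup>+x. f (v + x) \<partial>lborel) = (\<integral>\<^sup>+x. f x \<partial>lborel)"
  by (subst (2) lborel_distr_plus[symmetric, of v]) (simp add: nn_integral_distr)

lemma emeasure_lborel_cball_pos: "r > 0 \<Longrightarrow> emeasure lborel (cball (x::'a::euclidean_space) r) \<noteq> 0"
  using unit_ball_vol_pos[of "real DIM('a)"] by (simp add: emeasure_cball less_imp_neq[symmetric] del: unit_ball_vol_pos)

lemma emeasure_lborel_cball_finite: "emeasure lborel (cball (x::'a::euclidean_space) r) \<noteq> \<infinity>"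
  using emeasure_bounded_finite[of "cball x r"] by auto

text \<open>Integrating \<open>f x * g (x + y)\<close> over \<open>\<mu> \<times> lborel\<close>, with \<open>f\<close> and \<open>g\<close> the indicators of the unit
  ball and of \<open>A\<close>, and shifting either variable.\<close>

lemma translation_invariant_measure_unique:
  fixes \<mu> :: "'a::euclidean_space measure"
  assumes sets_eq [measurable_cong]: "sets \<mu> = sets borel"
    and shift: "\<And>f v. f \<in> borel_measurable borel \<Longrightarrow> (\<integral>\<^sup>+x. f (v + x) \<partial>\<mu>) = (\<integral>\<^sup>+x. f x \<partial>\<mu>)"
    and fin: "\<And>r. emeasure \<mu> (cball 0 r) \<noteq> \<infinity>"
    and A [measurable]: "A \<in> sets borel"
  shows "emeasure \<mu> A * emeasure lborel (cball (0::'a) 1) = emeasure lborel A * emeasure \<mu> (cball 0 1)"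
proof -
  interpret sigma_finite_measure \<mu>
  proof
    show "\<exists>A. countable A \<and> A \<subseteq> sets \<mu> \<and> \<Union>A = space \<mu> \<and> (\<forall>a\<in>A. emeasure \<mu> a \<noteq> \<infinity>)"
    proof (intro exI[of _ "range (\<lambda>n::nat. cball 0 (real n))"] conjI)
      show "\<Union> (range (\<lambda>n::nat. cball (0::'a) (real n))) = space \<mu>"
        using sets_eq_imp_space_eq[OF sets_eq] real_arch_simple by auto
    qed (use fin in \<open>auto simp: sets_eq\<close>)
  qed
  interpret pair_sigma_finite \<mu> lborel ..
  let ?C = "cball (0::'a) 1"
  have C_borel [measurable]: "?C \<in> sets borel"
    by simp
  then have C: "?C \<in> sets \<mu>"
    by (simp add: sets_eq)
  have pair_measurable: "g \<in> borel_measurable (\<mu> \<Otimes>\<^sub>M lborel)" if "g \<in> borel_measurable (borel \<Otimes>\<^sub>M borel)"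
    for g :: "'a \<times> 'a \<Rightarrow> ennreal"
    using that by (simp cong: measurable_cong_sets add: sets_pair_measure_cong[OF sets_eq sets_lborel])
  have "emeasure \<mu> ?C * emeasure lborel A =
      (\<integral>\<^sup>+x. (\<integral>\<^sup>+y. indicator ?C x * indicator A (x + y) \<partial>lborel) \<partial>\<mu>)"
  proof -
    have "(\<integral>\<^sup>+y. indicator ?C x * indicator A (x + y) \<partial>lborel) = indicator ?C x * emeasure lborel A" for x :: 'a
      by (subst nn_integral_cmult, measurable)
        (subst nn_integral_lborel_shift[of "indicator A"], auto)
    then show ?thesis
      using nn_integral_multc[OF borel_measurable_indicator[OF C], of "emeasure lborel A"]
      by (simp only: nn_integral_indicator[OF C])
  qed
  also have "\<dots> = (\<integral>\<^sup>+y. (\<integral>\<^sup>+x. indicator ?C x * indicator A (x + y) \<partial>\<mu>) \<partial>lborel)"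
    by (rule Fubini'[symmetric], rule pair_measurable) measurable
  also have "\<dots> = (\<integral>\<^sup>+y. (\<integral>\<^sup>+x. indicator ?C (x - y) * indicator A x \<partial>\<mu>) \<partial>lborel)"
  proof (rule nn_integral_cong)
    fix y :: 'a
    show "(\<integral>\<^sup>+x. indicator ?C x * indicator A (x + y) \<partial>\<mu>) = (\<integral>\<^sup>+x. indicator ?C (x - y) * indicator A x \<partial>\<mu>)"
      using shift[of "\<lambda>x. indicator ?C (x - y) * indicator A x" y] by (simp add: add.commute)
  qed
  also have "\<dots> = (\<integral>\<^sup>+x. (\<integral>\<^sup>+y. indicator ?C (x - y) * indicator A x \<partial>lborel) \<partial>\<mu>)"
    by (rule Fubini', rule pair_measurable) measurable
  also have "\<dots> = (\<integral>\<^sup>+x. indicator A x * emeasure lborel ?C \<partial>\<mu>)"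
  proof (rule nn_integral_cong)
    fix x :: 'a
    have "(\<integral>\<^sup>+y. indicator ?C (x - y) * indicator A x \<partial>lborel) = (\<integral>\<^sup>+y. indicator ?C (-x + y) \<partial>lborel) * indicator A x"
      by (subst nn_integral_multc, measurable)
        (auto intro!: arg_cong2[where f="(*)"] nn_integral_cong simp: indicator_def norm_minus_commute)
    also have "(\<integral>\<^sup>+y. indicator ?C (-x + y) \<partial>lborel) = emeasure lborel ?C"
      by (subst nn_integral_lborel_shift[of "indicator ?C"]) auto
    finally show "(\<integral>\<^sup>+y. indicator ?C (x - y) * indicator A x \<partial>lborel) = indicator A x * emeasure lborel ?C"
      by (simp add: mult.commute)
  qed
  also have "\<dots> = emeasure \<mu> A * emeasure lborel ?C"
    by (simp add: nn_integral_multc sets_eq)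
  finally show ?thesis
    by (simp add: mult.commute)
qed

lemma PiM_lborel_shift:
  assumes "finite I"
  shows "distr (\<Pi>\<^sub>M i\<in>I. (lborel :: real measure)) (\<Pi>\<^sub>M i\<in>I. lborel) (\<lambda>c. \<lambda>i\<in>I. v i + c i) = (\<Pi>\<^sub>M i\<in>I. lborel)"
proof -
  interpret product_sigma_finite "\<lambda>_. lborel :: real measure"
    by standard
  show ?thesis
  proof (rule PiM_eqI[OF assms])
    fix A :: "'a \<Rightarrow> real set" assume A: "\<And>i. i \<in> I \<Longrightarrow> A i \<in> sets lborel"
    have [measurable]: "Pi\<^sub>E I A \<in> sets (\<Pi>\<^sub>M i\<in>I. lborel)"
      using A assms by auto
    have 1: "(\<lambda>x. v i + x) -` A i \<in> sets lborel" if "i \<in> I" for i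
      using measurable_sets[of "\<lambda>x. v i + x" borel borel "A i"] A[OF that] by simp
    have "emeasure (distr (\<Pi>\<^sub>M i\<in>I. (lborel :: real measure)) (\<Pi>\<^sub>M i\<in>I. lborel) (\<lambda>c. \<lambda>i\<in>I. v i + c i)) (Pi\<^sub>E I A)
      = emeasure (\<Pi>\<^sub>M i\<in>I. lborel) (Pi\<^sub>E I (\<lambda>i. (\<lambda>x. v i + x) -` A i))"
      by (subst emeasure_distr) (auto intro!: arg_cong2[where f=emeasure] simp: space_PiM PiE_iff)
    also have "\<dots> = (\<Prod>i\<in>I. emeasure lborel ((\<lambda>x. v i + x) -` A i))"
      using 1 by (intro emeasure_PiM assms) auto
    also have "\<dots> = (\<Prod>i\<in>I. emeasure lborel (A i))"
    proof (rule prod.cong)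
      fix i assume "i \<in> I"
      then have "A i \<in> sets borel" using A by auto
      then show "emeasure lborel ((\<lambda>x. v i + x) -` A i) = emeasure lborel (A i)"
        by (subst (2) lborel_distr_plus[symmetric, of "v i"]) (simp add: emeasure_distr)
    qed simp
    finally show "emeasure (distr (\<Pi>\<^sub>M i\<in>I. (lborel :: real measure)) (\<Pi>\<^sub>M i\<in>I. lborel) (\<lambda>c. \<lambda>i\<in>I. v i + c i)) (Pi\<^sub>E I A) = (\<Prod>i\<in>I. emeasure lborel (A i))" .
  qed simp
qed

lemma norm_sum_orthonormal:
  fixes B :: "'a::euclidean_space set"
  assumes "finite B" "pairwise orthogonal B" "\<And>b. b \<in> B \<Longrightarrow> norm b = 1"
  shows "(norm (\<Sum>b\<in>B. c b *\<^sub>R b))\<^sup>2 = (\<Sum>b\<in>B. (c b)\<^sup>2)"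
proof -
  have "(norm (\<Sum>b\<in>B. c b *\<^sub>R b))\<^sup>2 = (\<Sum>b\<in>B. (norm (c b *\<^sub>R b))\<^sup>2)"
    using assms by (intro norm_sum_Pythagorean) (auto simp: pairwise_def orthogonal_def)
  then show ?thesis using assms(3) by (simp add: power_mult_distrib)
qed

text \<open>Translating the image measure amounts to shifting the coordinates, so it is translation
  invariant and hence proportional to \<open>lborel\<close>. The factor is 1 because, by Pythagoras,
  a centred ball has the same description in any orthonormal coordinates.\<close>

lemma lborel_eq_distr_orthonormal:
  fixes B :: "'a::euclidean_space set"
  assumes B: "finite B" "pairwise orthogonal B" "\<And>b. b \<in> B \<Longrightarrow> norm b = 1" "card B = DIM('a)"
  shows "lborel = distr (\<Pi>\<^sub>M b\<in>B. (lborel::real measure)) borel (\<lambda>c. \<Sum>b\<in>B. c b *\<^sub>R b)" (is "_ = ?N")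
proof (rule measure_eqI)
  show "sets lborel = sets ?N" by simp
  fix A :: "'a set" assume "A \<in> sets lborel"
  then have A [measurable]: "A \<in> sets borel" by simp
  have ind: "independent B"
    using B by (intro pairwise_orthogonal_independent) force+
  then have span: "span B = UNIV"
    using B(4) by (metis dim_eq_card_independent dim_eq_full)
  have [measurable]: "(\<lambda>c. \<Sum>b\<in>B. c b *\<^sub>R b) \<in> (\<Pi>\<^sub>M b\<in>B. (lborel::real measure)) \<rightarrow>\<^sub>M borel"
    by measurable
  have norm_B: "norm (\<Sum>b\<in>B. c b *\<^sub>R b) = sqrt (\<Sum>b\<in>B. (c b)\<^sup>2)" for c
    using norm_sum_orthonormal[OF B(1-3), of c] by (metis norm_ge_zero real_sqrt_unique)
  have cball: "emeasure ?N (cball 0 r) = emeasure lborel (cball (0::'a) r)" if "r > 0" for r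
  proof -
    have "emeasure ?N (cball 0 r) = emeasure (\<Pi>\<^sub>M b\<in>B. (lborel::real measure))
       ({f. sqrt (\<Sum>i\<in>B. (f i)\<^sup>2) \<le> r} \<inter> space (Pi\<^sub>M B (\<lambda>_. lborel)))"
      by (subst emeasure_distr) (auto intro!: arg_cong2[where f=emeasure] simp flip: norm_B)
    then show ?thesis
      using that by (simp add: emeasure_cball_aux[OF B(1) that] emeasure_cball B(4))
  qed
  have "emeasure ?N A * emeasure lborel (cball (0::'a) 1) = emeasure lborel A * emeasure ?N (cball 0 1)"
  proof (rule translation_invariant_measure_unique)
    fix f :: "'a \<Rightarrow> ennreal" and v :: 'a assume [measurable]: "f \<in> borel_measurable borel"
    obtain u where u: "v = (\<Sum>b\<in>B. u b *\<^sub>R b)"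
      using span_finite[OF B(1)] span by auto
    have "(\<integral>\<^sup>+x. f (v + x) \<partial>?N) = (\<integral>\<^sup>+c. f (v + (\<Sum>b\<in>B. c b *\<^sub>R b)) \<partial>(\<Pi>\<^sub>M b\<in>B. lborel))"
      by (subst nn_integral_distr) auto
    also have "\<dots> = (\<integral>\<^sup>+c. f (\<Sum>b\<in>B. (\<lambda>i\<in>B. u i + c i) b *\<^sub>R b) \<partial>(\<Pi>\<^sub>M b\<in>B. lborel))"
      by (simp add: u algebra_simps sum.distrib)
    also have "\<dots> = (\<integral>\<^sup>+c. f (\<Sum>b\<in>B. c b *\<^sub>R b) \<partial>distr (\<Pi>\<^sub>M b\<in>B. lborel) (\<Pi>\<^sub>M b\<in>B. lborel) (\<lambda>c. \<lambda>i\<in>B. u i + c i))"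
      by (subst nn_integral_distr) auto
    also have "\<dots> = (\<integral>\<^sup>+x. f x \<partial>?N)"
      by (simp add: PiM_lborel_shift[OF B(1)] nn_integral_distr)
    finally show "(\<integral>\<^sup>+x. f (v + x) \<partial>?N) = (\<integral>\<^sup>+x. f x \<partial>?N)" .
  next
    fix r :: real
    \<comment> \<open>The formula for balls needs a positive radius, hence the detour through
      \<open>max r 1\<close>.\<close>
    have "emeasure ?N (cball 0 r) \<le> emeasure ?N (cball 0 (max r 1))"
      by (intro emeasure_mono) auto
    then show "emeasure ?N (cball 0 r) \<noteq> \<infinity>"
      using cball[of "max r 1"] emeasure_lborel_cball_finite[of "0::'a" "max r 1"]
      by (auto simp: top_unique)
  qed auto
  then have "emeasure lborel (cball (0::'a) 1) * emeasure ?N A = emeasure lborel (cball (0::'a) 1) * emeasure lborel A"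
    using cball[of 1] by (simp add: mult.commute)
  then show "emeasure lborel A = emeasure ?N A"
    using cball[of 1] emeasure_lborel_cball_pos[of 1 "0::'a"] emeasure_lborel_cball_finite[of "0::'a" 1]
    unfolding ennreal_mult_cancel_left by auto
qed

lemma hyperplane_basis_props:
  fixes \<omega> :: "'a::euclidean_space"
  assumes "norm \<omega> = 1"
  shows "finite (hyperplane_basis \<omega>)" "pairwise orthogonal (hyperplane_basis \<omega>)"
    "\<And>b. b \<in> hyperplane_basis \<omega> \<Longrightarrow> norm b = 1" "\<And>b. b \<in> hyperplane_basis \<omega> \<Longrightarrow> \<omega> \<bullet> b = 0"
    "card (hyperplane_basis \<omega>) = DIM('a) - 1" "\<omega> \<notin> hyperplane_basis \<omega>"
proof -
  let ?B = "hyperplane_basis \<omega>"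
  have *: "?B \<subseteq> hyperplane \<omega> 0" "pairwise orthogonal ?B" "\<forall>b\<in>?B. norm b = 1" "span ?B = hyperplane \<omega> 0"
    using orthonormal_basis_of_hyperplane_basis[of \<omega>] by (auto simp: orthonormal_basis_of_def)
  show "pairwise orthogonal ?B" by fact
  show "\<And>b. b \<in> ?B \<Longrightarrow> norm b = 1" "\<And>b. b \<in> ?B \<Longrightarrow> \<omega> \<bullet> b = 0" using * by (auto simp: hyperplane_def)
  have ind: "independent ?B"
    using * by (intro pairwise_orthogonal_independent) force+
  then show "finite ?B" by (simp add: independent_imp_finite)
  have "card ?B = dim (hyperplane \<omega> 0)"
    using ind *(4) by (metis dim_eq_card_independent dim_span)
  moreover have "\<omega> \<noteq> 0" using assms by auto
  ultimately show "card ?B = DIM('a) - 1"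
    by (simp add: hyperplane_def dim_hyperplane)
  show "\<omega> \<notin> ?B" using * assms by (auto simp: hyperplane_def dot_square_norm)
qed

text \<open>Adjoining \<omega> to the basis of its orthogonal complement gives orthonormal
  coordinates of the whole space; Tonelli with the \<omega>-coordinate outermost leaves the slice
  measures inside.\<close>

lemma nn_integral_hyperplane_slices:
  fixes \<omega> :: "'a::euclidean_space" and f :: "'a \<Rightarrow> ennreal"
  assumes \<omega>: "norm \<omega> = 1" and [measurable]: "f \<in> borel_measurable borel"
  shows "(\<integral>\<^sup>+x. f x \<partial>lborel) = (\<integral>\<^sup>+t. (\<integral>\<^sup>+x. f x \<partial>hyperplane_lborel \<omega> t) \<partial>lborel)"
proof -
  let ?B = "hyperplane_basis \<omega>"
  note B = hyperplane_basis_props[OF \<omega>]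
  interpret product_sigma_finite "\<lambda>_::'a. lborel :: real measure"
    by standard
  have eq: "lborel = distr (\<Pi>\<^sub>M b\<in>insert \<omega> ?B. (lborel::real measure)) borel (\<lambda>c. \<Sum>b\<in>insert \<omega> ?B. c b *\<^sub>R b)"
  proof (rule lborel_eq_distr_orthonormal)
    show "pairwise orthogonal (insert \<omega> ?B)"
      using B by (auto simp: pairwise_insert orthogonal_def inner_commute)
    show "card (insert \<omega> ?B) = DIM('a)"
      using B by simp
  qed (use B \<omega> in auto)
  have "(\<integral>\<^sup>+x. f x \<partial>lborel) = (\<integral>\<^sup>+c. f (\<Sum>b\<in>insert \<omega> ?B. c b *\<^sub>R b) \<partial>(\<Pi>\<^sub>M b\<in>insert \<omega> ?B. lborel))"
  proof -
    have "(\<integral>\<^sup>+x. f x \<partial>distr (\<Pi>\<^sub>M b\<in>insert \<omega> ?B. (lborel::real measure)) borel (\<lambda>c. \<Sum>b\<in>insert \<omega> ?B. c b *\<^sub>R b)) = (\<integral>\<^sup>+c. f (\<Sum>b\<in>insert \<omega> ?B. c b *\<^sub>R b) \<partial>(\<Pi>\<^sub>M b\<in>insert \<omega> ?B. lborel))"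
      by (subst nn_integral_distr) auto
    then show ?thesis
      by (subst eq)
  qed
  also have "\<dots> = (\<integral>\<^sup>+t. (\<integral>\<^sup>+c. f (t *\<^sub>R \<omega> + (\<Sum>b\<in>?B. c b *\<^sub>R b)) \<partial>(\<Pi>\<^sub>M b\<in>?B. lborel)) \<partial>lborel)"
  proof (subst product_nn_integral_insert_rev)
    have "(\<Sum>b\<in>?B. (c(\<omega> := t)) b *\<^sub>R b) = (\<Sum>b\<in>?B. c b *\<^sub>R b)" for c :: "'a \<Rightarrow> real" and t
      using B by (intro sum.cong) auto
    then show "(\<integral>\<^sup>+t. \<integral>\<^sup>+c. f (\<Sum>b\<in>insert \<omega> ?B. (c(\<omega> := t)) b *\<^sub>R b) \<partial>(\<Pi>\<^sub>M b\<in>?B. lborel) \<partial>lborel) =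
       (\<integral>\<^sup>+t. (\<integral>\<^sup>+c. f (t *\<^sub>R \<omega> + (\<Sum>b\<in>?B. c b *\<^sub>R b)) \<partial>(\<Pi>\<^sub>M b\<in>?B. lborel)) \<partial>lborel)"
      using B by simp
  qed (use B in auto)
  also have "\<dots> = (\<integral>\<^sup>+t. (\<integral>\<^sup>+x. f x \<partial>hyperplane_lborel \<omega> t) \<partial>lborel)"
    unfolding hyperplane_lborel_def by (subst nn_integral_distr) auto
  finally show ?thesis .
qed

section \<open>Interior balls of smooth domains\<close>

text \<open>\<open>Ck_on\<close> only provides continuity of second derivatives for each fixed pair
  of directions, so their bounds \<open>M v w\<close> on a compact ball depend on the directions.
  Expanding both directions in \<open>Basis\<close> replaces them by finite sums and makes
  \<open>L\<close> uniform; in between stands the mean value inequality.\<close>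

lemma C_infinity_derivative_locally_Lipschitz:
  fixes \<rho> :: "'a::euclidean_space \<Rightarrow> real"
  assumes "open U" "p \<in> U" "C_infinity_on U \<rho>"
  obtains r L where "r > 0" "L \<ge> 0" "ball p r \<subseteq> U"
    "\<And>x y v. x \<in> ball p r \<Longrightarrow> y \<in> ball p r \<Longrightarrow>
      \<bar>frechet_derivative \<rho> (at x) v - frechet_derivative \<rho> (at y) v\<bar> \<le> L * norm v * norm (x - y)"
proof -
  define F where "F = (\<lambda>v x. frechet_derivative \<rho> (at x) v)"
  define G where "G = (\<lambda>v w x. frechet_derivative (F v) (at x) w)"
  have C2: "Ck_on (Suc (Suc 0)) U \<rho>"
    using assms(3) by (simp only: C_infinity_on_def)
  have d1: "\<rho> differentiable (at x)" if "x \<in> U" for x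
    using C2 that by simp
  have d2: "F v differentiable (at x)" if "x \<in> U" for x v
    using C2 that by (simp add: F_def)
  have cont: "continuous_on U (G v w)" for v w
    using C2 by (simp add: F_def G_def)
  obtain r where r: "r > 0" "cball p r \<subseteq> U"
    using assms(1,2) open_contains_cball by blast
  have "\<exists>M. \<forall>x\<in>cball p r. \<bar>G v w x\<bar> \<le> M" for v w
  proof -
    have "compact (G v w ` cball p r)"
      using cont r by (intro compact_continuous_image) (auto intro: continuous_on_subset)
    then show ?thesis
      by (force dest!: compact_imp_bounded simp: bounded_iff)
  qed
  then obtain M where M: "\<And>v w x. x \<in> cball p r \<Longrightarrow> \<bar>G v w x\<bar> \<le> M v w"
    by metis
  define N where "N = (\<lambda>v. \<Sum>j\<in>(Basis::'a set). M v j)"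
  have M0: "M v w \<ge> 0" for v w
    using M[of p v w] r by (force intro: order_trans[OF abs_ge_zero])
  have Lip: "\<bar>F v x - F v y\<bar> \<le> N v * norm (x - y)" if "x \<in> ball p r" "y \<in> ball p r" for v x y
  proof -
    have "norm (F v x - F v y) \<le> N v * norm (x - y)"
    proof (rule differentiable_bound[of "ball p r"])
      fix z assume z: "z \<in> ball p r"
      then have zU: "z \<in> U" using r by auto
      show "(F v has_derivative (\<lambda>w. G v w z)) (at z within ball p r)"
        using d2[OF zU, of v] unfolding G_def
        by (simp add: frechet_derivative_works has_derivative_at_withinI)
      have lin: "linear (\<lambda>w. G v w z)"
        using linear_frechet_derivative[OF d2[OF zU, of v]] by (simp add: G_def)
      show "onorm (\<lambda>w. G v w z) \<le> N v"
      proof (rule onorm_le)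
        fix w
        have "G v w z = G v (\<Sum>j\<in>Basis. (w \<bullet> j) *\<^sub>R j) z"
          by (simp add: euclidean_representation)
        also have "\<dots> = (\<Sum>j\<in>Basis. (w \<bullet> j) * G v j z)"
          using linear_sum[OF lin, of "\<lambda>j. (w \<bullet> j) *\<^sub>R j" Basis] linear_cmul[OF lin] by simp
        also have "norm \<dots> \<le> (\<Sum>j\<in>Basis. norm w * M v j)"
          using M z by (intro sum_norm_le) (auto simp: abs_mult intro!: mult_mono Basis_le_norm)
        finally show "norm (G v w z) \<le> N v * norm w"
          by (simp add: N_def sum_distrib_left mult.commute)
      qed
    qed (use that in auto)
    then show ?thesis by simp
  qed
  define L where "L = (\<Sum>i\<in>(Basis::'a set). N i)"
  show thesis
  proof (rule that)
    show "r > 0" "ball p r \<subseteq> U" using r ball_subset_cball by blast+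
    show "L \<ge> 0" unfolding L_def N_def by (intro sum_nonneg M0)
    fix x y v assume xy: "x \<in> ball p r" "y \<in> ball p r"
    have rep: "F v z = (\<Sum>i\<in>Basis. (v \<bullet> i) * F i z)" if "z \<in> ball p r" for z
    proof -
      have lin: "linear (\<lambda>w. F w z)"
        using linear_frechet_derivative[OF d1[of z]] that r by (auto simp: F_def subset_iff)
      moreover have "F v z = F (\<Sum>j\<in>Basis. (v \<bullet> j) *\<^sub>R j) z"
        by (simp add: euclidean_representation)
      ultimately show ?thesis
        using linear_sum[OF lin, of "\<lambda>j. (v \<bullet> j) *\<^sub>R j" Basis] linear_cmul[OF lin] by simp
    qed
    have "\<bar>F v x - F v y\<bar> = norm (\<Sum>i\<in>Basis. (v \<bullet> i) * (F i x - F i y))"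
      using xy by (simp add: rep sum_subtractf right_diff_distrib)
    also have "\<dots> \<le> (\<Sum>i\<in>Basis. norm v * (N i * norm (x - y)))"
      using xy by (intro sum_norm_le) (auto simp: abs_mult intro!: mult_mono Basis_le_norm Lip)
    also have "\<dots> = L * norm v * norm (x - y)"
      by (simp add: L_def sum_distrib_left sum_distrib_right mult_ac)
    finally show "\<bar>frechet_derivative \<rho> (at x) v - frechet_derivative \<rho> (at y) v\<bar> \<le> L * norm v * norm (x - y)"
      by (simp add: F_def)
  qed
qed

lemma power2_norm_diff:
  fixes x y :: "'a::real_inner"
  shows "(norm (x - y))\<^sup>2 = (norm x)\<^sup>2 - 2 * (x \<bullet> y) + (norm y)\<^sup>2"
  by (simp add: power2_norm_eq_inner inner_diff_left inner_diff_right inner_commute)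

text \<open>A ball in \<open>D\<close> touching the frontier at \<open>p\<close> forces the
  derivative of \<rho> at \<open>p\<close> to be a nonpositive multiple of the inner product with
  the unit vector \<open>u\<close> from \<open>p\<close> towards \<open>x\<close>. Near
  \<open>p0\<close> its slope is at most \<open>-a/2\<close>, so with \<open>v = z - p\<close> the
  value at \<open>z\<close> is at most \<open>-(a/2) (v . u) + (L + 1) |v|^2\<close>. In the tangent
  ball of radius \<open>R'\<close> one has \<open>|v|^2 < 2 R' (v . u)\<close>, and the linear term
  wins once \<open>R'\<close> is small.\<close>

lemma local_interior_ball:
  fixes D :: "'a::euclidean_space set"
  assumes D: "open D" "C_infinity_boundary D" and p0: "p0 \<in> frontier D"
  shows "\<exists>R>0. \<exists>e>0. \<forall>p\<in>frontier D \<inter> ball p0 e. \<forall>x R'. x \<noteq> p \<longrightarrow> ball x (dist x p) \<subseteq> D \<longrightarrow> 0 < R' \<longrightarrow> R' \<le> R \<longrightarrow>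
     ball (p + (R' / dist x p) *\<^sub>R (x - p)) R' \<subseteq> D"
proof -
  obtain U \<rho> where U: "open U" "p0 \<in> U" "C_infinity_on U \<rho>"
    and nz: "\<And>x. x \<in> U \<Longrightarrow> frechet_derivative \<rho> (at x) \<noteq> (\<lambda>_. 0)"
    and DU: "D \<inter> U = {x\<in>U. \<rho> x < 0}"
    using bspec[OF D(2)[unfolded C_infinity_boundary_def] p0] by metis
  define F where "F = (\<lambda>x. frechet_derivative \<rho> (at x))"
  have "Ck_on (Suc 0) U \<rho>"
    using U(3) by (simp only: C_infinity_on_def)
  then have der: "(\<rho> has_derivative F x) (at x)" if "x \<in> U" for x
    using that by (simp add: F_def frechet_derivative_works[symmetric])
  have lin: "linear (F x)" if "x \<in> U" for x
    using der[OF that] by (rule has_derivative_linear)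
  have contr: "isCont \<rho> x" if "x \<in> U" for x
    using der[OF that] by (rule has_derivative_continuous)
  obtain r L where r: "r > 0" "L \<ge> 0" "ball p0 r \<subseteq> U"
    and Lip: "\<And>x y v. x \<in> ball p0 r \<Longrightarrow> y \<in> ball p0 r \<Longrightarrow> \<bar>F x v - F y v\<bar> \<le> L * norm v * norm (x - y)"
    using C_infinity_derivative_locally_Lipschitz[OF U] unfolding F_def by metis
  obtain w0 where "F p0 w0 \<noteq> 0" using nz[OF U(2)] by (auto simp: F_def fun_eq_iff)
  define a where "a = \<bar>F p0 w0\<bar> / norm w0"
  have w0: "w0 \<noteq> 0"
    using \<open>F p0 w0 \<noteq> 0\<close> lin[OF U(2)] linear_0 by blast
  have a: "a > 0" using w0 \<open>F p0 w0 \<noteq> 0\<close> by (simp add: a_def)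
  \<comment> \<open>\<open>a\<close> is the slope of \<rho> at \<open>p0\<close> along
    \<open>w0\<close>. The bound on \<open>e\<close> costs at most half of this slope when passing
    from \<open>p0\<close> to \<open>p\<close>; the bound on \<open>R\<close> keeps
    \<open>2 * (L + 1) * R'\<close> below \<open>a / 4\<close>. The terms in \<open>r\<close> keep
    the tangent ball inside \<open>ball p0 r\<close>, and \<open>L + 1\<close> provides a positive
    divisor.\<close>
  define e where "e = min (r / 2) (a / (2 * (L + 1)))"
  have e: "e > 0" using r a by (simp add: e_def)
  define R where "R = min (r / 4) (a / (8 * (L + 1)))"
  have R: "R > 0" using r a by (simp add: R_def)
  show ?thesis
  proof (rule exI[of _ R], rule conjI[OF R], rule exI[of _ e], rule conjI[OF e], intro ballI allI impI subsetI)
    fix p x R' z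
    assume p: "p \<in> frontier D \<inter> ball p0 e" and xp: "x \<noteq> p" and ball: "ball x (dist x p) \<subseteq> D"
      and R': "0 < R'" "R' \<le> R" and z: "z \<in> ball (p + (R' / dist x p) *\<^sub>R (x - p)) R'"
    define d where "d = dist x p"
    have d: "d > 0" using xp by (simp add: d_def)
    define u where "u = (1 / d) *\<^sub>R (x - p)"
    have u: "norm u = 1" using d by (simp add: u_def d_def dist_norm)
    have x: "x = p + d *\<^sub>R u" using d by (simp add: u_def)
    have pr: "p \<in> ball p0 r" and pU: "p \<in> U" using p r by (auto simp: e_def)
    have "\<rho> p = 0"
    proof (rule antisym)
      have "p \<notin> D" using p D(1) by (auto simp: frontier_def interior_open)
      then have "p \<notin> {x \<in> U. \<rho> x < 0}" using DU by auto
      then show "\<rho> p \<ge> 0" using pU by simp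
      show "\<rho> p \<le> 0"
      proof (rule ccontr)
        assume "\<not> \<rho> p \<le> 0"
        then have "\<forall>\<^sub>F y in at p. \<rho> y > 0"
          using contr[OF pU] by (auto simp: isCont_def intro: order_tendstoD)
        then obtain V where V: "open V" "p \<in> V" "\<And>y. y \<in> V \<Longrightarrow> y \<noteq> p \<Longrightarrow> \<rho> y > 0"
          unfolding eventually_at_topological by blast
        have "p \<in> closure D" using p by (simp add: frontier_def)
        moreover have "open (V \<inter> U)" "p \<in> V \<inter> U" using V U pU by auto
        ultimately obtain y where y: "y \<in> D" "y \<in> V \<inter> U"
          using open_Int_closure_eq_empty[of "V \<inter> U" D] by blast
        then have "\<rho> y < 0" using DU by auto
        then show False using V(3)[of y] y \<open>\<not> \<rho> p \<le> 0\<close> by force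
      qed
    qed
    \<comment> \<open>A direction with \<open>v . u > 0\<close> points into the touching ball, where
      \<rho> is negative, so \<rho> cannot increase along it from its value 0 at
      \<open>p\<close>.\<close>
    have neg: "F p v \<le> 0" if v: "v \<bullet> u > 0" for v
    proof (rule ccontr)
      assume *: "\<not> F p v \<le> 0"
      have "((\<lambda>t. \<rho> (p + t *\<^sub>R v)) has_real_derivative F p v) (at 0)"
      proof -
        have "((\<lambda>t. \<rho> (p + t *\<^sub>R v)) has_derivative (\<lambda>t. F p (t *\<^sub>R v))) (at 0)"
          by (rule has_derivative_compose[of "\<lambda>t. p + t *\<^sub>R v", where g=\<rho>, simplified])
             (auto intro!: derivative_eq_intros der pU)
        then show ?thesis
          by (simp add: has_field_derivative_def linear_cmul[OF lin[OF pU]] mult.commute[of _ "F p v"])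
      qed
      then obtain s where s: "s > 0" "\<And>t. 0 < t \<Longrightarrow> t < s \<Longrightarrow> \<rho> p < \<rho> (p + t *\<^sub>R v)"
        using DERIV_pos_inc_right[of "\<lambda>t. \<rho> (p + t *\<^sub>R v)" "F p v" 0] * by auto
      have "open ((\<lambda>t. p + t *\<^sub>R v) -` U)"
        by (intro open_vimage U continuous_intros)
      moreover have "0 \<in> (\<lambda>t. p + t *\<^sub>R v) -` U" using pU by simp
      ultimately obtain s' where s'0: "s' > 0" "ball 0 s' \<subseteq> (\<lambda>t. p + t *\<^sub>R v) -` U"
        using openE by blast
      have s': "p + t *\<^sub>R v \<in> U" if "\<bar>t\<bar> < s'" for t
        using subsetD[OF s'0(2), of t] that by auto
      have v0: "v \<noteq> 0" using v by auto
      \<comment> \<open>The last term gives \<open>t |v|^2 \<le> d (v . u)\<close>, whereas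
        \<open>t |v|^2 < 2 d (v . u)\<close> already places \<open>p + t v\<close> in the ball about
        \<open>x\<close>. The other two keep the point in \<open>U\<close> and in the range where
        \<rho> exceeds its value at \<open>p\<close>.\<close>
      define t where "t = min (min (s / 2) (s' / 2)) (d * (v \<bullet> u) / (norm v)\<^sup>2)"
      have t: "t > 0" "t < s" "t < s'" using s s'0 d v v0 by (auto simp: t_def)
      have "t * (norm v)\<^sup>2 \<le> d * (v \<bullet> u)"
        using v0 by (simp add: t_def field_simps min_def)
      then have tv: "t * (norm v)\<^sup>2 < 2 * d * (v \<bullet> u)" using mult_pos_pos[OF d v] by (simp add: mult.assoc)
      have "(norm (t *\<^sub>R v - d *\<^sub>R u))\<^sup>2 = d\<^sup>2 - t * (2 * d * (v \<bullet> u) - t * (norm v)\<^sup>2)"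
        using u by (simp add: power2_norm_diff power_mult_distrib) (simp add: algebra_simps power2_eq_square)
      also have "\<dots> < d\<^sup>2" using t tv by simp
      finally have "norm (t *\<^sub>R v - d *\<^sub>R u) < d" using d power2_less_imp_less by (metis less_imp_le)
      then have "p + t *\<^sub>R v \<in> ball x d" by (simp add: x dist_norm norm_minus_commute)
      then have "p + t *\<^sub>R v \<in> D" using ball by (auto simp: d_def)
      then have "\<rho> (p + t *\<^sub>R v) < 0" using DU s'[of t] t by auto
      with s(2)[of t] t \<open>\<rho> p = 0\<close> show False by simp
    qed
    note linp = lin[OF pU]
    \<comment> \<open>A vector orthogonal to \<open>u\<close> is the limit of \<open>v + c u\<close>
      as \<open>c\<close> tends to 0. Applied to a vector and its negative, this makes the
      derivative vanish on the orthogonal complement of \<open>u\<close>.\<close>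
    have perp: "F p v \<le> 0" if "v \<bullet> u = 0" for v
    proof (rule field_le_epsilon)
      fix \<epsilon> :: real assume \<epsilon>: "\<epsilon> > 0"
      define c where "c = \<epsilon> / (\<bar>F p u\<bar> + 1)"
      have c: "c > 0" using \<epsilon> by (simp add: c_def)
      have "F p (v + c *\<^sub>R u) \<le> 0"
        using c that u by (intro neg) (simp add: inner_add_left norm_eq_1)
      then have "F p v \<le> c * (- F p u)" by (simp add: linear_add[OF linp] linear_cmul[OF linp])
      also have "\<dots> \<le> c * (\<bar>F p u\<bar> + 1)" using c by (intro mult_left_mono) auto
      also have "\<dots> = \<epsilon>" by (simp add: c_def)
      finally show "F p v \<le> 0 + \<epsilon>" by simp
    qed
    have Fp: "F p v = (v \<bullet> u) * F p u" for v
    proof -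
      let ?v = "v - (v \<bullet> u) *\<^sub>R u"
      have "?v \<bullet> u = 0" "(- ?v) \<bullet> u = 0" using u by (auto simp: inner_diff_left norm_eq_1)
      then have "F p ?v = 0" using perp[of ?v] perp[of "- ?v"] linear_neg[OF linp, of ?v] by linarith
      then show ?thesis by (simp add: linear_diff[OF linp] linear_cmul[OF linp])
    qed
    have "\<bar>F p u\<bar> \<ge> a / 2"
    proof -
      have "a * norm w0 = \<bar>F p0 w0\<bar>" using w0 by (simp add: a_def)
      also have "\<dots> \<le> \<bar>F p w0\<bar> + L * norm w0 * norm (p - p0)"
        using Lip[of p p0 w0] pr r by simp
      also have "\<bar>F p w0\<bar> \<le> norm w0 * \<bar>F p u\<bar>"
        using Fp[of w0] Cauchy_Schwarz_ineq2[of w0 u] u by (simp add: abs_mult mult_right_mono)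
      also have "L * norm w0 * norm (p - p0) \<le> norm w0 * (a / 2)"
      proof -
        have "norm (p - p0) \<le> a / (2 * (L + 1))" using p by (simp add: e_def dist_norm norm_minus_commute)
        then have "L * norm (p - p0) \<le> (L + 1) * (a / (2 * (L + 1)))"
          using r a by (intro mult_mono) auto
        also have "\<dots> = a / 2" using r by (simp add: field_simps)
        finally have "norm w0 * (L * norm (p - p0)) \<le> norm w0 * (a / 2)" by (intro mult_left_mono) auto
        then show ?thesis by (simp add: mult_ac)
      qed
      finally have "norm w0 * a \<le> norm w0 * (\<bar>F p u\<bar> + a / 2)" by (simp add: algebra_simps)
      then show ?thesis using w0 by simp
    qed
    moreover have "F p u \<le> 0" using neg[of u] u by (cases "u = 0") auto
    ultimately have Fu: "F p u \<le> - (a / 2)" by simp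
    define v where "v = z - p"
    have "norm (v - R' *\<^sub>R u) < R'"
      using z by (simp add: v_def u_def d_def dist_norm norm_minus_commute algebra_simps)
    then have "(norm (v - R' *\<^sub>R u))\<^sup>2 < R'\<^sup>2" by (simp add: power_strict_mono)
    moreover have "(norm (v - R' *\<^sub>R u))\<^sup>2 = (norm v)\<^sup>2 - 2 * R' * (v \<bullet> u) + R'\<^sup>2"
      using u by (simp add: power2_norm_diff power_mult_distrib)
    ultimately have v2: "(norm v)\<^sup>2 < 2 * R' * (v \<bullet> u)" by simp
    then have "0 < 2 * R' * (v \<bullet> u)" by (meson le_less_trans zero_le_power2)
    then have vu: "v \<bullet> u > 0" using R' by (simp add: zero_less_mult_iff)
    have "norm v \<le> norm (v - R' *\<^sub>R u) + norm (R' *\<^sub>R u)" by (metis diff_add_cancel norm_triangle_ineq)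
    then have vR: "norm v < r / 2" using \<open>norm (v - R' *\<^sub>R u) < R'\<close> R' u by (simp add: R_def)
    have seg: "p + t *\<^sub>R v \<in> ball p0 r" if "0 \<le> t" "t \<le> 1" for t
    proof -
      have "dist p0 (p + t *\<^sub>R v) \<le> dist p0 p + norm (t *\<^sub>R v)"
        by (metis add.commute diff_add_cancel dist_norm dist_triangle norm_minus_commute add_diff_cancel_left')
      also have "norm (t *\<^sub>R v) \<le> norm v" using that by (simp add: mult_left_le_one_le)
      finally show ?thesis using p vR by (simp add: e_def)
    qed
    have "\<exists>t. 0 < t \<and> t < 1 \<and> \<rho> (p + 1 *\<^sub>R v) - \<rho> (p + 0 *\<^sub>R v) = (1 - 0) * F (p + t *\<^sub>R v) v"
    proof (rule MVT2)
      fix t :: real assume t: "0 \<le> t" "t \<le> 1"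
      then have tU: "p + t *\<^sub>R v \<in> U" using seg r by blast
      have "((\<lambda>t. \<rho> (p + t *\<^sub>R v)) has_derivative (\<lambda>s. F (p + t *\<^sub>R v) (s *\<^sub>R v))) (at t)"
        by (rule has_derivative_compose[of "\<lambda>t. p + t *\<^sub>R v", where g=\<rho>, simplified])
           (auto intro!: derivative_eq_intros der tU)
      then show "((\<lambda>t. \<rho> (p + t *\<^sub>R v)) has_real_derivative F (p + t *\<^sub>R v) v) (at t)"
        by (simp add: has_field_derivative_def linear_cmul[OF lin[OF tU]] mult.commute[of _ "F (p + t *\<^sub>R v) v"])
    qed simp
    then obtain t where t: "0 < t" "t < 1" "\<rho> z = F (p + t *\<^sub>R v) v"
      using \<open>\<rho> p = 0\<close> by (auto simp: v_def)
    have "\<rho> z \<le> F p v + L * norm v * norm (t *\<^sub>R v)"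
      using Lip[of "p + t *\<^sub>R v" p v] seg[of t] t pr by simp
    also have "\<dots> \<le> F p v + (L + 1) * (norm v)\<^sup>2"
    proof -
      have "L * norm v * norm (t *\<^sub>R v) = (t * L) * (norm v)\<^sup>2" using t by (simp add: power2_eq_square)
      also have "\<dots> \<le> (L + 1) * (norm v)\<^sup>2"
        using t r mult_left_le_one_le[of L t] by (intro mult_right_mono) auto
      finally show ?thesis by simp
    qed
    also have "\<dots> \<le> - (a / 2) * (v \<bullet> u) + (L + 1) * (norm v)\<^sup>2"
      using Fp[of v] Fu vu mult_right_mono[OF Fu, of "v \<bullet> u"] by (simp add: mult.commute)
    also have "\<dots> < - (a / 2) * (v \<bullet> u) + (L + 1) * (2 * R' * (v \<bullet> u))"
      using v2 r by simp
    also have "\<dots> = (2 * (L + 1) * R' - a / 2) * (v \<bullet> u)" by (simp add: algebra_simps)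
    also have "\<dots> \<le> 0"
    proof -
      have "(L + 1) * R' \<le> (L + 1) * (a / (8 * (L + 1)))" using R' r by (intro mult_left_mono) (auto simp: R_def)
      also have "\<dots> = a / 8" using r by (simp add: field_simps)
      finally have "2 * (L + 1) * R' - a / 2 \<le> 0" using a by (simp add: algebra_simps)
      then show ?thesis using vu by (intro mult_nonpos_nonneg) auto
    qed
    finally have "\<rho> z < 0" .
    moreover have "z \<in> U" using seg[of 1] r by (auto simp: v_def)
    ultimately show "z \<in> D" using DU by auto
  qed
qed

text \<open>Let \<open>p\<close> be a frontier point nearest to \<open>x\<close>; the ball about
  \<open>x\<close> up to \<open>p\<close> is connected and misses the frontier, so it lies in
  \<open>D\<close>. If it is too small, its centre is moved along the ray from \<open>p\<close>
  through \<open>x\<close> until the radius is \<open>R\<close>: the new ball still touches at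
  \<open>p\<close>, lies in \<open>D\<close> by the local lemma, and contains \<open>x\<close>. A
  finite subcover of the frontier provides a common \<open>R\<close>.\<close>

lemma uniform_interior_ball:
  fixes D :: "'a::euclidean_space set"
  assumes D: "bounded_domain D" "C_infinity_boundary D"
  shows "\<exists>R>0. \<forall>x\<in>D. \<exists>c. x \<in> ball c R \<and> ball c R \<subseteq> D"
proof -
  have D': "open D" "D \<noteq> {}" "bounded D" using D by (auto simp: bounded_domain_def)
  have cF: "compact (frontier D)" using D' by (simp add: compact_frontier_bounded)
  have ne: "frontier D \<noteq> {}"
    using D' frontier_not_empty[of D] not_bounded_UNIV by blast
  obtain Rf ef where Rf: "\<And>q. q \<in> frontier D \<Longrightarrow> Rf q > 0" and ef: "\<And>q. q \<in> frontier D \<Longrightarrow> ef q > (0::real)"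
    and inner: "\<And>q p x R'. q \<in> frontier D \<Longrightarrow> p \<in> frontier D \<inter> ball q (ef q) \<Longrightarrow> x \<noteq> p \<Longrightarrow> ball x (dist x p) \<subseteq> D \<Longrightarrow> 0 < R' \<Longrightarrow> R' \<le> Rf q \<Longrightarrow>
     ball (p + (R' / dist x p) *\<^sub>R (x - p)) R' \<subseteq> D"
    using local_interior_ball[OF D'(1) D(2)] by metis
  obtain C where C: "C \<subseteq> frontier D" "finite C" "frontier D \<subseteq> (\<Union>q\<in>C. ball q (ef q))"
    using compactE_image[OF cF, of "frontier D" "\<lambda>q. ball q (ef q)"] ef by force
  have "C \<noteq> {}" using C ne by auto
  define R where "R = Min (Rf ` C)"
  have R: "R > 0" using C Rf \<open>C \<noteq> {}\<close> by (auto simp: R_def)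
  show ?thesis
  proof (intro exI[of _ R] conjI R ballI)
    fix x assume x: "x \<in> D"
    obtain p where p: "p \<in> frontier D" and near: "\<And>q. q \<in> frontier D \<Longrightarrow> dist x p \<le> dist x q"
      using distance_attains_inf[of "frontier D" x] ne by auto
    have "x \<noteq> p" using p x D'(1) by (auto simp: frontier_def interior_open)
    have b: "ball x (dist x p) \<subseteq> D"
    proof (rule ccontr)
      assume "\<not> ball x (dist x p) \<subseteq> D"
      moreover have "x \<in> ball x (dist x p) \<inter> D"
        using x \<open>x \<noteq> p\<close> by simp
      ultimately have "ball x (dist x p) \<inter> frontier D \<noteq> {}"
        by (intro connected_Int_frontier connected_ball) blast+
      then show False using near by force
    qed
    show "\<exists>c. x \<in> ball c R \<and> ball c R \<subseteq> D"
    proof (cases "R \<le> dist x p")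
      case True
      then show ?thesis using b R by (intro exI[of _ x]) auto
    next
      case False
      obtain q where q: "q \<in> C" "p \<in> ball q (ef q)" using C p by blast
      then have "R \<le> Rf q" using C by (auto simp: R_def)
      then have "ball (p + (R / dist x p) *\<^sub>R (x - p)) R \<subseteq> D"
        using inner[of q p x R] q C p \<open>x \<noteq> p\<close> b R by auto
      moreover have "x \<in> ball (p + (R / dist x p) *\<^sub>R (x - p)) R"
      proof -
        have "p + (R / dist x p) *\<^sub>R (x - p) - x = (R / dist x p - 1) *\<^sub>R (x - p)"
          by (simp add: algebra_simps)
        then have "dist (p + (R / dist x p) *\<^sub>R (x - p)) x = \<bar>R / dist x p - 1\<bar> * dist x p"
          by (simp add: dist_norm)
        also have "\<dots> = \<bar>(R / dist x p - 1) * dist x p\<bar>" by (simp add: abs_mult)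
        also have "(R / dist x p - 1) * dist x p = R - dist x p" using \<open>x \<noteq> p\<close> by (simp add: field_simps)
        finally show ?thesis using False \<open>x \<noteq> p\<close> by simp
      qed
      ultimately show ?thesis by blast
    qed
  qed
qed

section \<open>Support functions and cap volumes\<close>

definition support_fun :: "'a::euclidean_space set \<Rightarrow> 'a \<Rightarrow> real" where
  "support_fun D y = (SUP x\<in>D. x \<bullet> y)"

locale bounded_nonempty =
  fixes D :: "'a::euclidean_space set"
  assumes bounded_D: "bounded D" and nonempty_D: "D \<noteq> {}"
begin

abbreviation "H \<equiv> support_fun D"

lemma bdd_above_inner: "bdd_above ((\<lambda>x. x \<bullet> y) ` D)"
proof -
  obtain K where K: "\<And>x. x \<in> D \<Longrightarrow> norm x \<le> K" using bounded_D by (auto simp: bounded_iff)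
  have "x \<bullet> y \<le> K * norm y" if "x \<in> D" for x
    using norm_cauchy_schwarz[of x y] mult_right_mono[OF K[OF that], of "norm y"] by simp
  then show ?thesis by (auto simp: bdd_above_def)
qed

lemma inner_le_support: "x \<in> D \<Longrightarrow> x \<bullet> y \<le> H y"
  unfolding support_fun_def by (rule cSUP_upper[OF _ bdd_above_inner])

lemma less_support_iff: "t < H y \<longleftrightarrow> (\<exists>x\<in>D. t < x \<bullet> y)"
  unfolding support_fun_def using nonempty_D by (rule less_cSUP_iff[OF _ bdd_above_inner])

lemma support_leI: "(\<And>x. x \<in> D \<Longrightarrow> x \<bullet> y \<le> t) \<Longrightarrow> H y \<le> t"
  unfolding support_fun_def using nonempty_D by (rule cSUP_least)

lemma support_scale:
  assumes "r > 0"
  shows "H (r *\<^sub>R y) = r * H y"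
proof (rule antisym)
  show "H (r *\<^sub>R y) \<le> r * H y"
    using assms by (intro support_leI) (simp add: inner_le_support)
  have "H y \<le> H (r *\<^sub>R y) / r"
    using assms inner_le_support[of _ "r *\<^sub>R y"] by (intro support_leI) (simp add: field_simps)
  then show "r * H y \<le> H (r *\<^sub>R y)" using assms by (simp add: field_simps)
qed

lemma continuous_support: "continuous_on S H"
proof -
  obtain K where K: "K > 0" "\<And>x. x \<in> D \<Longrightarrow> norm x \<le> K" using bounded_D by (auto simp: bounded_pos)
  have le: "H y \<le> H z + K * norm (y - z)" for y z
  proof (rule support_leI)
    fix x assume x: "x \<in> D"
    have "x \<bullet> y = x \<bullet> z + x \<bullet> (y - z)" by (simp add: inner_diff_right)
    also have "x \<bullet> (y - z) \<le> K * norm (y - z)"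
      using norm_cauchy_schwarz[of x "y - z"] mult_right_mono[OF K(2)[OF x], of "norm (y - z)"] by simp
    finally show "x \<bullet> y \<le> H z + K * norm (y - z)" using inner_le_support[OF x, of z] by simp
  qed
  have "K-lipschitz_on S H"
  proof (rule lipschitz_onI)
    show "dist (H y) (H z) \<le> K * dist y z" for y z
      using le[of y z] le[of z y] by (simp add: dist_norm norm_minus_commute abs_le_iff)
  qed (use K in auto)
  then show ?thesis by (rule lipschitz_on_continuous_on)
qed

lemma measurable_support [measurable]: "H \<in> borel_measurable borel"
  by (rule borel_measurable_continuous_onI) (rule continuous_support)

lemma support_ge_ball:
  assumes "ball c r \<subseteq> D" "r > 0"
  shows "c \<bullet> y + r * norm y \<le> H y"
proof (rule field_le_epsilon)
  fix \<epsilon> :: real assume \<epsilon>: "\<epsilon> > 0"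
  \<comment> \<open>The supremum over the open ball need not be attained, so the radius is shrunk to
    \<open>q\<close> at a cost of at most \<epsilon>; \<open>norm y + 1\<close> avoids a zero
    divisor and \<open>max 0\<close> a negative radius.\<close>
  define q where "q = max 0 (r - \<epsilon> / (norm y + 1))"
  have q: "0 \<le> q" "q < r" "r * norm y \<le> q * norm y + \<epsilon>"
  proof -
    have "0 < norm y + 1" by (smt (verit) norm_ge_zero)
    then have "\<epsilon> / (norm y + 1) * norm y \<le> \<epsilon>" "0 < \<epsilon> / (norm y + 1)"
      using \<epsilon> by (auto simp: field_simps)
    then show "0 \<le> q" "q < r" using assms by (auto simp: q_def)
    have "r - \<epsilon> / (norm y + 1) \<le> q" by (simp add: q_def)
    then have "(r - \<epsilon> / (norm y + 1)) * norm y \<le> q * norm y" by (intro mult_right_mono) auto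
    then show "r * norm y \<le> q * norm y + \<epsilon>"
      using \<open>\<epsilon> / (norm y + 1) * norm y \<le> \<epsilon>\<close> by (simp add: left_diff_distrib)
  qed
  have "norm (sgn y) \<le> 1" by (simp add: norm_sgn)
  then have "norm (q *\<^sub>R sgn y) \<le> q" using q mult_left_mono[of "norm (sgn y)" 1 q] by simp
  then have "c + q *\<^sub>R sgn y \<in> ball c r" using q by (simp add: dist_norm)
  then have "(c + q *\<^sub>R sgn y) \<bullet> y \<le> H y" using assms by (intro inner_le_support) auto
  moreover have "sgn y \<bullet> y = norm y"
    by (cases "y = 0") (simp_all add: sgn_div_norm power2_norm_eq_inner[symmetric] power2_eq_square)
  ultimately show "c \<bullet> y + r * norm y \<le> H y + \<epsilon>" using q by (simp add: inner_add_left)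
qed

lemma inner_less_support:
  assumes "open D" "x \<in> D" "y \<noteq> 0"
  shows "x \<bullet> y < H y"
proof -
  obtain r where "r > 0" "ball x r \<subseteq> D" using assms openE by blast
  then have "x \<bullet> y + r * norm y \<le> H y" by (intro support_ge_ball)
  moreover have "r * norm y > 0" using \<open>r > 0\<close> assms by simp
  ultimately show ?thesis by linarith
qed

text \<open>This makes the polynomial identity available on the whole open interval between the two
  extreme hyperplanes, although it is only assumed for hyperplanes that meet
  \<open>D\<close>.\<close>

lemma connected_slices:
  assumes "connected D" "- H (- y) < t" "t < H y"
  shows "\<exists>x\<in>D. y \<bullet> x = t"
proof -
  obtain x1 where x1: "x1 \<in> D" "t < x1 \<bullet> y" using assms(3) less_support_iff by blast
  obtain x2 where x2: "x2 \<in> D" "x2 \<bullet> y < t"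
    using assms(2) less_support_iff[of "- t" "- y"] by auto
  show ?thesis
    using connected_ivt_hyperplane[OF assms(1) x2(1) x1(1), of y t] x1 x2 by (auto simp: inner_commute)
qed

end

section \<open>Slices in orthonormal coordinates and the mean volume of caps\<close>

lemma hyperplane_coords:
  fixes \<omega> :: "'a::euclidean_space"
  assumes "norm \<omega> = 1"
  defines "B \<equiv> hyperplane_basis \<omega>"
  shows "(t *\<^sub>R \<omega> + (\<Sum>b\<in>B. c b *\<^sub>R b)) \<bullet> \<omega> = t"
    "(norm (t *\<^sub>R \<omega> + (\<Sum>b\<in>B. c b *\<^sub>R b)))\<^sup>2 = t\<^sup>2 + (\<Sum>b\<in>B. (c b)\<^sup>2)"
proof -
  note B = hyperplane_basis_props[OF assms(1), folded B_def]
  have *: "(\<Sum>b\<in>B. c b *\<^sub>R b) \<bullet> \<omega> = 0"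
    using B(4) by (simp add: inner_sum_right inner_commute[of _ \<omega>])
  then show "(t *\<^sub>R \<omega> + (\<Sum>b\<in>B. c b *\<^sub>R b)) \<bullet> \<omega> = t"
    using assms(1) by (simp add: inner_add_left norm_eq_1)
  have "(norm (t *\<^sub>R \<omega> + (\<Sum>b\<in>B. c b *\<^sub>R b)))\<^sup>2 = (norm (t *\<^sub>R \<omega>))\<^sup>2 + (norm (\<Sum>b\<in>B. c b *\<^sub>R b))\<^sup>2"
    using * by (intro norm_add_Pythagorean) (simp add: orthogonal_def inner_commute)
  then show "(norm (t *\<^sub>R \<omega> + (\<Sum>b\<in>B. c b *\<^sub>R b)))\<^sup>2 = t\<^sup>2 + (\<Sum>b\<in>B. (c b)\<^sup>2)"
    using norm_sum_orthonormal[OF B(1-3)] assms(1) by (simp add: power_mult_distrib)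
qed

lemma emeasure_hyperplane_slices:
  fixes \<omega> :: "'a::euclidean_space"
  assumes "norm \<omega> = 1" "A \<in> sets borel"
  shows "emeasure lborel A = (\<integral>\<^sup>+t. emeasure (hyperplane_lborel \<omega> t) A \<partial>lborel)"
proof -
  have "sets (hyperplane_lborel \<omega> t) = sets borel" for t
    by (simp add: hyperplane_lborel_def)
  then show ?thesis
    using nn_integral_hyperplane_slices[OF assms(1), of "indicator A"] assms(2) by simp
qed

text \<open>The set is the part in the unit ball of a cylinder of radius \<delta> with axis
  \<omega>. Each slice lies in a cube of side \<open>2 * \<delta>\<close>, and only heights in
  [-1, 1] occur, which gives the factor 2.\<close>

lemma emeasure_cylinder_le:
  fixes \<omega> :: "'a::euclidean_space"
  assumes \<omega>: "norm \<omega> = 1" and \<delta>: "\<delta> \<ge> 0"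
  shows "emeasure lborel {y. norm y \<le> 1 \<and> (norm y)\<^sup>2 - (y \<bullet> \<omega>)\<^sup>2 \<le> \<delta>\<^sup>2} \<le> ennreal (2 * (2 * \<delta>) ^ (DIM('a) - 1))"
    (is "emeasure lborel ?A \<le> _")
proof -
  define B where "B = hyperplane_basis \<omega>"
  note B = hyperplane_basis_props[OF \<omega>, folded B_def] and coords = hyperplane_coords[OF \<omega>, folded B_def]
  interpret product_sigma_finite "\<lambda>_::'a. lborel :: real measure"
    by standard
  have A: "?A \<in> sets borel" by measurable
  have "emeasure (hyperplane_lborel \<omega> t) ?A \<le> ennreal ((2 * \<delta>) ^ (DIM('a) - 1)) * indicator {-1..1} t" for t
  proof -
    have sub: "{c \<in> B \<rightarrow>\<^sub>E UNIV. t *\<^sub>R \<omega> + (\<Sum>b\<in>B. c b *\<^sub>R b) \<in> ?A} \<subseteq> (if t \<in> {-1..1} then (\<Pi>\<^sub>E b\<in>B. {-\<delta>..\<delta>}) else {})"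
    proof
      fix c assume c: "c \<in> {c \<in> B \<rightarrow>\<^sub>E UNIV. t *\<^sub>R \<omega> + (\<Sum>b\<in>B. c b *\<^sub>R b) \<in> ?A}"
      define y where "y = t *\<^sub>R \<omega> + (\<Sum>b\<in>B. c b *\<^sub>R b)"
      have y: "norm y \<le> 1" "(norm y)\<^sup>2 - t\<^sup>2 \<le> \<delta>\<^sup>2" "y \<bullet> \<omega> = t" "(norm y)\<^sup>2 = t\<^sup>2 + (\<Sum>b\<in>B. (c b)\<^sup>2)"
        using c coords[of t c] by (auto simp: y_def)
      have "\<bar>t\<bar> \<le> 1" using Cauchy_Schwarz_ineq2[of y \<omega>] y \<omega> by simp
      moreover have "c b \<in> {-\<delta>..\<delta>}" if "b \<in> B" for b
      proof -
        have "(c b)\<^sup>2 \<le> (\<Sum>b\<in>B. (c b)\<^sup>2)" using that B(1) by (intro member_le_sum) auto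
        then have "(c b)\<^sup>2 \<le> \<delta>\<^sup>2" using y by simp
        then show ?thesis using \<delta> abs_le_square_iff[of "c b" \<delta>] by auto
      qed
      ultimately show "c \<in> (if t \<in> {-1..1} then (\<Pi>\<^sub>E b\<in>B. {-\<delta>..\<delta>}) else {})"
        using c by (auto simp: PiE_iff)
    qed
    have S: "(\<Pi>\<^sub>E b\<in>B. {-\<delta>..\<delta>}) \<in> sets (\<Pi>\<^sub>M b\<in>B. lborel)"
      using B(1) by (intro sets_PiM_I_finite) auto
    have "emeasure (hyperplane_lborel \<omega> t) ?A \<le> emeasure (\<Pi>\<^sub>M b\<in>B. lborel) (if t \<in> {-1..1} then (\<Pi>\<^sub>E b\<in>B. {-\<delta>..\<delta>}) else {})"
      unfolding emeasure_hyperplane_lborel[OF A] B_def[symmetric] using S by (intro emeasure_mono sub) auto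
    also have "\<dots> = ennreal ((2 * \<delta>) ^ (DIM('a) - 1)) * indicator {-1..1} t"
      using B(1,5) \<delta> by (simp add: emeasure_PiM ennreal_power)
    finally show ?thesis .
  qed
  then have "emeasure lborel ?A \<le> (\<integral>\<^sup>+t. ennreal ((2 * \<delta>) ^ (DIM('a) - 1)) * indicator {-1..1::real} t \<partial>lborel)"
    unfolding emeasure_hyperplane_slices[OF \<omega> A] by (intro nn_integral_mono)
  also have "\<dots> = ennreal (2 * (2 * \<delta>) ^ (DIM('a) - 1))"
    using \<delta> by (subst nn_integral_cmult_indicator) (auto simp: ennreal_mult mult.commute)
  finally show ?thesis .
qed

text \<open>The source of the exponent \<open>m\<close>. With \<open>x - c = |w| e\<close>, the
  support function of the ball gives \<open>R |y| - |w| (y . e) < s\<close> with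
  \<open>|w| < R\<close>. Hence the squared distance of \<open>y\<close> from the axis
  \<open>e\<close> is at most \<open>2 s / R\<close>, so \<open>y\<close> lies in a cylinder of
  radius \<open>sqrt (2 s / R)\<close>, whose volume carries the power \<open>n - 1 = 2 m\<close> of
  that radius.\<close>

lemma (in bounded_nonempty) emeasure_near_support_le:
  assumes R: "R > 0" "x \<in> ball c R" "ball c R \<subseteq> D" and s: "s > 0" and dim: "DIM('a) = 2 * m + 1"
  shows "emeasure lborel {y. norm y \<le> 1 \<and> H y - x \<bullet> y < s} \<le> ennreal (2 * (8 * s / R) ^ m)"
proof -
  define w where "w = x - c"
  \<comment> \<open>If \<open>x\<close> is the centre of its ball, any unit vector serves as the
    axis.\<close>
  obtain e :: 'a where e: "norm e = 1" "w = norm w *\<^sub>R e"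
  proof (cases "w = 0")
    case True
    then show ?thesis using that[of "SOME b. b \<in> Basis"] nonempty_Basis norm_Basis
      by (metis norm_zero scaleR_zero_left some_in_eq)
  next
    case False
    then show ?thesis using that[of "sgn w"] by (simp add: norm_sgn sgn_div_norm)
  qed
  define \<delta> where "\<delta> = sqrt (2 * s / R)"
  have \<delta>: "\<delta> \<ge> 0" "\<delta>\<^sup>2 = 2 * s / R" using R s by (auto simp: \<delta>_def)
  have "{y. norm y \<le> 1 \<and> H y - x \<bullet> y < s} \<subseteq> {y. norm y \<le> 1 \<and> (norm y)\<^sup>2 - (y \<bullet> e)\<^sup>2 \<le> \<delta>\<^sup>2}"
  proof safe
    fix y assume y: "norm y \<le> 1" "H y - x \<bullet> y < s"
    have "c \<bullet> y + R * norm y \<le> H y" using R by (intro support_ge_ball)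
    moreover have "x \<bullet> y = c \<bullet> y + norm w * (y \<bullet> e)"
      using e(2) by (metis (no_types) add.commute diff_add_cancel inner_add_left inner_commute inner_scaleR_left w_def)
    ultimately have *: "R * norm y - norm w * (y \<bullet> e) < s" using y by simp
    have w: "norm w < R" using R by (simp add: w_def dist_norm norm_minus_commute)
    have ye: "\<bar>y \<bullet> e\<bar> \<le> norm y" using Cauchy_Schwarz_ineq2[of y e] e by simp
    have "R * ((norm y)\<^sup>2 - (y \<bullet> e)\<^sup>2) \<le> 2 * s"
    proof (cases "y \<bullet> e \<ge> 0")
      case True
      then have "R * (norm y - y \<bullet> e) \<le> s"
        using * mult_right_mono[of "norm w" R "y \<bullet> e"] w by (simp add: right_diff_distrib)
      then have "R * (norm y - y \<bullet> e) * (norm y + y \<bullet> e) \<le> s * 2"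
        using s True y ye by (intro mult_mono) auto
      then show ?thesis by (simp add: power2_eq_square algebra_simps)
    next
      case False
      then have "norm w * (y \<bullet> e) \<le> 0" by (simp add: mult_nonneg_nonpos)
      then have "R * norm y < s" using * by simp
      moreover have "(norm y)\<^sup>2 \<le> norm y"
        using y mult_left_le_one_le[of "norm y" "norm y"] by (simp add: power2_eq_square)
      then have "R * ((norm y)\<^sup>2 - (y \<bullet> e)\<^sup>2) \<le> R * norm y"
        using R by (intro mult_left_mono) (auto intro: order_trans[rotated])
      ultimately show ?thesis using s by simp
    qed
    then show "(norm y)\<^sup>2 - (y \<bullet> e)\<^sup>2 \<le> \<delta>\<^sup>2" using R unfolding \<delta>(2) by (simp add: field_simps)
  qed
  then have "emeasure lborel {y. norm y \<le> 1 \<and> H y - x \<bullet> y < s} \<le> emeasure lborel {y. norm y \<le> 1 \<and> (norm y)\<^sup>2 - (y \<bullet> e)\<^sup>2 \<le> \<delta>\<^sup>2}"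
    by (intro emeasure_mono) auto
  also have "\<dots> \<le> ennreal (2 * (2 * \<delta>) ^ (DIM('a) - 1))"
    by (intro emeasure_cylinder_le e \<delta>)
  also have "(2 * \<delta>) ^ (DIM('a) - 1) = (8 * s / R) ^ m"
    using \<delta> by (simp add: dim power_mult power_mult_distrib)
  finally show ?thesis .
qed

text \<open>By Tonelli, the mean of the cap volumes over the directions is the integral over \<open>x\<close> of the
  measure of the directions whose cap contains \<open>x\<close>; the interior ball condition bounds the latter
  by a constant times \<open>s ^ m\<close>, and it vanishes for small \<open>s\<close>.\<close>

lemma (in bounded_nonempty) AE_liminf_cap_volume:
  assumes D: "open D" and R: "R > 0" "\<And>x. x \<in> D \<Longrightarrow> \<exists>c. x \<in> ball c R \<and> ball c R \<subseteq> D"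
    and dim: "DIM('a) = 2 * m + 1"
  shows "AE y in lborel. 1/2 < norm y \<and> norm y < 1 \<longrightarrow>
    liminf (\<lambda>k. ennreal (real (Suc k) ^ m) * emeasure lborel {x \<in> D. H y - 1 / real (Suc k) < x \<bullet> y}) = 0"
proof -
  have [measurable]: "D \<in> sets borel" using D by simp
  define A where "A = {y::'a. 1/2 < norm y \<and> norm y < 1}"
  have [measurable]: "A \<in> sets borel" unfolding A_def by measurable
  define F where "F = (\<lambda>k x y. ennreal (real (Suc k) ^ m) * indicator D x * indicator A y * indicator {..<1 / real (Suc k)} (H y - x \<bullet> y))"
  have [measurable]: "(\<lambda>(x, y). F k x y) \<in> borel_measurable (lborel \<Otimes>\<^sub>M lborel)" for k
    unfolding F_def by measurable
  define g where "g = (\<lambda>k x. \<integral>\<^sup>+y. F k x y \<partial>lborel)"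
  define f where "f = (\<lambda>k y. \<integral>\<^sup>+x. F k x y \<partial>lborel)"
  have [measurable]: "g k \<in> borel_measurable lborel" "f k \<in> borel_measurable lborel" for k
    unfolding g_def f_def by measurable
  have fg: "(\<integral>\<^sup>+y. f k y \<partial>lborel) = (\<integral>\<^sup>+x. g k x \<partial>lborel)" for k
    unfolding f_def g_def by (rule lborel_pair.Fubini') simp
  have g_le: "g k x \<le> ennreal (2 * (8 / R) ^ m) * indicator D x" for k x
  proof (cases "x \<in> D")
    case True
    then obtain c where c: "x \<in> ball c R" "ball c R \<subseteq> D" using R by blast
    have "g k x \<le> (\<integral>\<^sup>+y. ennreal (real (Suc k) ^ m) * indicator {y. norm y \<le> 1 \<and> H y - x \<bullet> y < 1 / real (Suc k)} y \<partial>lborel)"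
      unfolding g_def F_def A_def by (intro nn_integral_mono) (auto simp: indicator_def)
    also have "\<dots> = ennreal (real (Suc k) ^ m) * emeasure lborel {y. norm y \<le> 1 \<and> H y - x \<bullet> y < 1 / real (Suc k)}"
      by (subst nn_integral_cmult_indicator) auto
    also have "\<dots> \<le> ennreal (real (Suc k) ^ m) * ennreal (2 * (8 * (1 / real (Suc k)) / R) ^ m)"
      using R c by (intro mult_left_mono emeasure_near_support_le dim) auto
    also have "\<dots> = ennreal (2 * (8 / R) ^ m)"
      using R by (subst ennreal_mult[symmetric]) (auto simp: power_divide power_mult_distrib)
    finally show ?thesis using True by simp
  qed (simp add: g_def F_def)
  \<comment> \<open>A ball about \<open>x\<close> in \<open>D\<close> keeps
    \<open>H y - x . y\<close> above a positive constant on the annulus, so \<open>x\<close> belongs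
    to no cap of small height. Together with the bound \<open>g_le\<close> this is what turns O into
    o.\<close>
  have g_lim: "(\<lambda>k. g k x) \<longlonglongrightarrow> 0" for x
  proof (cases "x \<in> D")
    case True
    then obtain r where r: "r > 0" "ball x r \<subseteq> D" using D openE by blast
    have "\<forall>\<^sub>F k in sequentially. 1 / real (Suc k) < r / 2"
      using r LIMSEQ_inverse_real_of_nat by (intro order_tendstoD(2)[of _ 0]) (auto simp: inverse_eq_divide)
    then have "\<forall>\<^sub>F k in sequentially. g k x = 0"
    proof eventually_elim
      case (elim k)
      have "F k x y = 0" for y
      proof (cases "y \<in> A")
        case True
        have "x \<bullet> y + r * norm y \<le> H y" using r by (intro support_ge_ball)
        moreover have "r * (1/2) \<le> r * norm y" using True r by (intro mult_left_mono) (auto simp: A_def)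
        ultimately show ?thesis using elim by (simp add: F_def)
      qed (simp add: F_def)
      then have "g k x = (\<integral>\<^sup>+y. 0 \<partial>(lborel :: 'a measure))" unfolding g_def by (intro nn_integral_cong)
      then show ?case by simp
    qed
    then show ?thesis by (rule tendsto_eventually)
  qed (simp add: g_def F_def)
  have "(\<lambda>k. \<integral>\<^sup>+x. g k x \<partial>lborel) \<longlonglongrightarrow> (\<integral>\<^sup>+x. 0 \<partial>(lborel :: 'a measure))"
  proof (rule nn_integral_dominated_convergence[where w="\<lambda>x. ennreal (2 * (8 / R) ^ m) * indicator D x"])
    show "(\<integral>\<^sup>+x. ennreal (2 * (8 / R) ^ m) * indicator D x \<partial>lborel) < \<infinity>"
      using emeasure_bounded_finite[OF bounded_D]
      by (subst nn_integral_cmult_indicator) (auto simp: ennreal_mult_less_top less_top)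
  qed (auto simp: g_le g_lim)
  then have "(\<lambda>k. \<integral>\<^sup>+y. f k y \<partial>lborel) \<longlonglongrightarrow> 0" by (simp add: fg)
  then have lim0: "liminf (\<lambda>k. \<integral>\<^sup>+y. f k y \<partial>lborel) = 0"
    by (intro lim_imp_Liminf) auto
  \<comment> \<open>Fatou's lemma: the means tend to 0, hence the lower limit is 0 almost
    everywhere. A lower limit is enough later, since a zero of too small order bounds all late terms
    from below.\<close>
  have "(\<integral>\<^sup>+y. liminf (\<lambda>k. f k y) \<partial>lborel) \<le> liminf (\<lambda>k. \<integral>\<^sup>+y. f k y \<partial>lborel)"
    by (rule nn_integral_liminf) simp
  then have "(\<integral>\<^sup>+y. liminf (\<lambda>k. f k y) \<partial>lborel) = 0" using lim0 by simp
  then have "AE y in lborel. liminf (\<lambda>k. f k y) = 0"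
    by (subst (asm) nn_integral_0_iff_AE) auto
  then show ?thesis
  proof (rule AE_mp, intro AE_I2 impI)
    fix y :: 'a assume y: "liminf (\<lambda>k. f k y) = 0" "1/2 < norm y \<and> norm y < 1"
    have "f k y = ennreal (real (Suc k) ^ m) * emeasure lborel {x \<in> D. H y - 1 / real (Suc k) < x \<bullet> y}" for k
    proof -
      have "f k y = (\<integral>\<^sup>+x. ennreal (real (Suc k) ^ m) * indicator {x \<in> D. H y - 1 / real (Suc k) < x \<bullet> y} x \<partial>lborel)"
        unfolding f_def F_def using y by (intro nn_integral_cong) (auto simp: indicator_def A_def)
      then show ?thesis by (simp add: nn_integral_cmult_indicator)
    qed
    then show "liminf (\<lambda>k. ennreal (real (Suc k) ^ m) * emeasure lborel {x \<in> D. H y - 1 / real (Suc k) < x \<bullet> y}) = 0"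
      using y by simp
  qed
qed

section \<open>Vanishing of the section polynomial\<close>

text \<open>\<open>section_volume\<close> is a \<open>measure\<close>, which is 0 by default for
  sets of infinite measure; finiteness excludes this case.\<close>

lemma emeasure_hyperplane_bounded_finite:
  fixes \<omega> :: "'a::euclidean_space"
  assumes \<omega>: "norm \<omega> = 1" and S: "S \<in> sets borel" "bounded S"
  shows "emeasure (hyperplane_lborel \<omega> t) S < \<infinity>"
proof -
  define B where "B = hyperplane_basis \<omega>"
  note B = hyperplane_basis_props[OF \<omega>, folded B_def] and coords = hyperplane_coords[OF \<omega>, folded B_def]
  interpret product_sigma_finite "\<lambda>_::'a. lborel :: real measure"
    by standard
  obtain K where K: "K > 0" "\<And>x. x \<in> S \<Longrightarrow> norm x \<le> K" using S(2) by (auto simp: bounded_pos)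
  have "{c \<in> B \<rightarrow>\<^sub>E UNIV. t *\<^sub>R \<omega> + (\<Sum>b\<in>B. c b *\<^sub>R b) \<in> S} \<subseteq> (\<Pi>\<^sub>E b\<in>B. {-K..K})"
  proof
    fix c assume c: "c \<in> {c \<in> B \<rightarrow>\<^sub>E UNIV. t *\<^sub>R \<omega> + (\<Sum>b\<in>B. c b *\<^sub>R b) \<in> S}"
    define y where "y = t *\<^sub>R \<omega> + (\<Sum>b\<in>B. c b *\<^sub>R b)"
    have y: "norm y \<le> K" "(norm y)\<^sup>2 = t\<^sup>2 + (\<Sum>b\<in>B. (c b)\<^sup>2)"
      using c coords[of t c] K by (auto simp: y_def)
    have "c b \<in> {-K..K}" if "b \<in> B" for b
    proof -
      have "(c b)\<^sup>2 \<le> (\<Sum>b\<in>B. (c b)\<^sup>2)" using that B(1) by (intro member_le_sum) auto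
      also have "\<dots> \<le> (norm y)\<^sup>2" using y by simp
      also have "\<dots> \<le> K\<^sup>2" using y by (intro power_mono) auto
      finally show ?thesis using K abs_le_square_iff[of "c b" K] by auto
    qed
    then show "c \<in> (\<Pi>\<^sub>E b\<in>B. {-K..K})" using c by (auto simp: PiE_iff)
  qed
  then have "emeasure (hyperplane_lborel \<omega> t) S \<le> emeasure (\<Pi>\<^sub>M b\<in>B. lborel) (\<Pi>\<^sub>E b\<in>B. {-K..K})"
    unfolding emeasure_hyperplane_lborel[OF S(1)] B_def[symmetric]
    using B(1) by (intro emeasure_mono sets_PiM_I_finite) auto
  also have "\<dots> < \<infinity>"
    using B(1) K by (subst emeasure_PiM) (auto simp: ennreal_power)
  finally show ?thesis .
qed

lemma emeasure_slab_eq: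
  fixes \<omega> :: "'a::euclidean_space"
  assumes \<omega>: "norm \<omega> = 1" and S [measurable]: "S \<in> sets borel" and "bounded S" and A [measurable]: "A \<in> sets borel"
  shows "emeasure lborel {x\<in>S. \<omega> \<bullet> x \<in> A} = (\<integral>\<^sup>+t. ennreal (section_volume S \<omega> t) * indicator A t \<partial>lborel)"
proof -
  have "emeasure (hyperplane_lborel \<omega> t) {x\<in>S. \<omega> \<bullet> x \<in> A} = ennreal (section_volume S \<omega> t) * indicator A t" for t
  proof -
    have h [measurable]: "hyperplane \<omega> t \<in> sets borel"
      unfolding hyperplane_def by (intro borel_closed closed_hyperplane)
    have c: "\<omega> \<bullet> (t *\<^sub>R \<omega> + (\<Sum>b\<in>hyperplane_basis \<omega>. c b *\<^sub>R b)) = t" for c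
      using hyperplane_coords(1)[OF \<omega>] by (simp add: inner_commute)
    have "emeasure (hyperplane_lborel \<omega> t) {x\<in>S. \<omega> \<bullet> x \<in> A} =
        emeasure (hyperplane_lborel \<omega> t) (if t \<in> A then S \<inter> hyperplane \<omega> t else {})"
      by (subst (1 2) emeasure_hyperplane_lborel) (auto simp: hyperplane_def c intro!: arg_cong2[where f=emeasure])
    moreover have "emeasure (hyperplane_lborel \<omega> t) (S \<inter> hyperplane \<omega> t) = ennreal (section_volume S \<omega> t)"
      unfolding section_volume_def using emeasure_hyperplane_bounded_finite[OF \<omega>, of "S \<inter> hyperplane \<omega> t" t] assms(3)
      by (intro emeasure_eq_ennreal_measure) (auto simp: bounded_Int)
    ultimately show ?thesis by simp
  qed
  then show ?thesis
    by (simp add: emeasure_hyperplane_slices[OF \<omega>])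
qed

text \<open>\<phi> is the density of the image of Lebesgue measure on \<open>S\<close> under the
  inner product with \<omega>. Equality for almost every \<open>t\<close> suffices, which lets the
  unit ball ignore its two tangent hyperplanes.\<close>

lemma integral_slab_eq:
  fixes \<omega> :: "'a::euclidean_space" and \<phi> g :: "real \<Rightarrow> real"
  assumes \<omega>: "norm \<omega> = 1" and S [measurable]: "S \<in> sets borel" and "bounded S"
    and \<phi>: "AE t in lborel. section_volume S \<omega> t = \<phi> t" and [measurable]: "\<phi> \<in> borel_measurable borel" "g \<in> borel_measurable borel"
  shows "(LINT x:S|lborel. g (\<omega> \<bullet> x)) = (LINT t|lborel. \<phi> t * g t)"
proof -
  have \<phi>0: "AE t in lborel. 0 \<le> \<phi> t"
    using \<phi> by eventually_elim (metis measure_nonneg section_volume_def)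
  let ?M = "distr (density lborel (\<lambda>x. ennreal (indicator S x))) borel (\<lambda>x. \<omega> \<bullet> x)"
  have eq: "?M = density lborel (\<lambda>t. ennreal (\<phi> t))"
  proof (rule measure_eqI)
    fix A assume "A \<in> sets ?M"
    then have A [measurable]: "A \<in> sets borel" by simp
    have "emeasure ?M A = (\<integral>\<^sup>+x. ennreal (indicator S x) * indicator {x. \<omega> \<bullet> x \<in> A} x \<partial>lborel)"
      by (subst emeasure_distr, measurable, subst emeasure_density, measurable) (simp add: vimage_def)
    also have "\<dots> = (\<integral>\<^sup>+x. indicator {x\<in>S. \<omega> \<bullet> x \<in> A} x \<partial>lborel)"
      by (intro nn_integral_cong) (auto simp: indicator_def)
    also have "\<dots> = emeasure lborel {x\<in>S. \<omega> \<bullet> x \<in> A}"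
      by (rule nn_integral_indicator) measurable
    also have "\<dots> = (\<integral>\<^sup>+t. ennreal (\<phi> t) * indicator A t \<partial>lborel)"
      unfolding emeasure_slab_eq[OF \<omega> S \<open>bounded S\<close> A] using \<phi> by (intro nn_integral_cong_AE) auto
    also have "\<dots> = emeasure (density lborel (\<lambda>t. ennreal (\<phi> t))) A"
      by (simp add: emeasure_density)
    finally show "emeasure ?M A = emeasure (density lborel (\<lambda>t. ennreal (\<phi> t))) A" .
  qed simp
  have "(LINT x:S|lborel. g (\<omega> \<bullet> x)) = integral\<^sup>L (density lborel (\<lambda>x. ennreal (indicator S x))) (\<lambda>x. g (\<omega> \<bullet> x))"
    unfolding set_lebesgue_integral_def by (subst integral_density) auto
  also have "\<dots> = integral\<^sup>L ?M g"
    by (subst integral_distr) auto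
  also have "\<dots> = (LINT t|lborel. \<phi> t * g t)"
    unfolding eq using \<phi>0 by (subst integral_density) auto
  finally show ?thesis .
qed

text \<open>\<open>sphere_measure\<close> is a positive multiple of the image of Lebesgue measure on
  the punctured ball under radial projection, so the cone over a null set of directions is a
  Lebesgue null set.\<close>

lemma AE_sphere_measure_imp_AE_lborel:
  fixes P :: "'a::euclidean_space \<Rightarrow> bool"
  assumes "AE \<omega> in sphere_measure. P \<omega>"
  shows "AE y in lborel. y \<in> ball 0 1 - {0} \<longrightarrow> P (y /\<^sub>R norm y)"
proof -
  obtain N where N: "{\<omega> \<in> space sphere_measure. \<not> P \<omega>} \<subseteq> N" "emeasure sphere_measure N = 0" "N \<in> sets sphere_measure"
    using assms by (rule AE_E)
  have N': "N \<in> sets borel" "N \<subseteq> sphere 0 1"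
    using N(3) by (auto simp: sets_sphere_measure sets_restrict_space)
  have [measurable]: "N \<in> sets borel" by fact
  have "of_nat DIM('a) * emeasure lborel {x \<in> ball 0 1 - {0}. x /\<^sub>R norm x \<in> N} = 0"
    using N(2) emeasure_sphere_measure[OF N'] by simp
  then have "emeasure lborel {x \<in> ball (0::'a) 1 - {0}. x /\<^sub>R norm x \<in> N} = 0"
    by simp
  moreover have "{x \<in> ball (0::'a) 1 - {0}. x /\<^sub>R norm x \<in> N} \<in> sets lborel"
    by measurable
  ultimately show ?thesis
  proof (rule_tac AE_I[rotated])
    show "{y \<in> space lborel. \<not> (y \<in> ball 0 1 - {0} \<longrightarrow> P (y /\<^sub>R norm y))} \<subseteq> {x \<in> ball (0::'a) 1 - {0}. x /\<^sub>R norm x \<in> N}"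
      using N(1) by (auto simp: space_sphere_measure)
  qed
qed

text \<open>Carries the cap estimate from \<open>y\<close> to \<open>- y\<close>, that is, to the
  opposite end of the interval of heights.\<close>

lemma AE_lborel_uminus:
  fixes P :: "'a::euclidean_space \<Rightarrow> bool"
  assumes "AE y in lborel. P y"
  shows "AE y in lborel. P (- y)"
proof -
  have "lborel = density (distr lborel borel (\<lambda>x::'a. 0 + (-1) *\<^sub>R x)) (\<lambda>_. 1)"
    using lborel_affine[of "-1" "0::'a"] by simp
  then have *: "(lborel :: 'a measure) = distr lborel borel uminus"
    by (simp add: density_1)
  have "AE y in distr lborel borel uminus. P y"
    using assms * by metis
  then show ?thesis by (rule AE_distrD[rotated]) simp
qed

text \<open>\<open>E s\<close> stands for the volume of the cap of height \<open>s\<close> over the endpoint \<open>e\<close>; \<open>\<sigma> = 1\<close> for the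
  left and \<open>\<sigma> = -1\<close> for the right endpoint.\<close>

lemma power_dvd_of_cap_liminf:
  fixes P :: "real poly" and E :: "real \<Rightarrow> ennreal"
  assumes r: "r > 0" and \<sigma>: "\<sigma> = 1 \<or> \<sigma> = -1" and d: "d > 0"
    and nonneg: "\<And>t. 0 < \<sigma> * (t - e) \<Longrightarrow> \<sigma> * (t - e) < d \<Longrightarrow> poly P t \<ge> 0"
    and cap: "\<And>s c. 0 < s \<Longrightarrow> s < d \<Longrightarrow> c \<ge> 0 \<Longrightarrow> (\<And>t. s / 2 < \<sigma> * (t - e) \<Longrightarrow> \<sigma> * (t - e) < s \<Longrightarrow> c \<le> poly P t)
      \<Longrightarrow> ennreal (c * (s / 2)) \<le> E s"
    and lim: "liminf (\<lambda>k. ennreal (real (Suc k) ^ m) * E (1 / (r * real (Suc k)))) = 0"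
  shows "[:- e, 1:] ^ m dvd P"
proof (rule ccontr)
  assume "\<not> ?thesis"
  then have "P \<noteq> 0" and ord: "order e P < m" by (auto simp: order_divides)
  define j where "j = order e P"
  obtain Q where Q: "P = [:- e, 1:] ^ j * Q" "\<not> [:- e, 1:] dvd Q"
    using order_decomp[OF \<open>P \<noteq> 0\<close>] unfolding j_def by blast
  have Qe: "poly Q e \<noteq> 0" using Q(2) by (simp add: poly_eq_0_iff_dvd)
  define c where "c = \<bar>poly Q e\<bar> / 2"
  have c: "c > 0" using Qe by (simp add: c_def)
  have "isCont (\<lambda>t. \<bar>poly Q t\<bar>) e" by (intro continuous_intros)
  then have "\<forall>\<^sub>F t in at e. c < \<bar>poly Q t\<bar>"
    unfolding isCont_def by (rule order_tendstoD) (use c in \<open>simp add: c_def\<close>)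
  then obtain \<eta> where \<eta>: "\<eta> > 0" "\<And>t. t \<noteq> e \<Longrightarrow> dist t e < \<eta> \<Longrightarrow> c < \<bar>poly Q t\<bar>"
    unfolding eventually_at by blast
  have abs\<sigma>: "\<bar>t - e\<bar> = \<bar>\<sigma> * (t - e)\<bar>" for t using \<sigma> by auto
  \<comment> \<open>Near \<open>e\<close> the polynomial is at least \<open>c |t - e|^j\<close>. On
    the outer half of the cap, of width \<open>s / 2\<close>, this is at least
    \<open>c (s / 2)^j\<close>, so the cap has volume at least \<open>c (s / 2)^(j + 1)\<close>.
    Since \<open>j + 1 \<le> m\<close> and \<open>s / 2 < 1\<close>, the exponent can be raised to
    \<open>m\<close>.\<close>
  have E_ge: "ennreal (c * (s / 2) ^ m) \<le> E s" if s: "0 < s" "s < min d (min \<eta> 1)" for s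
  proof -
    have "ennreal (c * (s / 2) ^ m) \<le> ennreal (c * (s / 2) ^ Suc j)"
      using s c ord by (intro ennreal_leI mult_left_mono power_decreasing) (auto simp: j_def)
    also have "\<dots> = ennreal (c * (s / 2) ^ j * (s / 2))" by (simp add: mult_ac)
    also have "\<dots> \<le> E s"
    proof (rule cap)
      fix t assume t: "s / 2 < \<sigma> * (t - e)" "\<sigma> * (t - e) < s"
      have "poly P t = \<bar>poly P t\<bar>" using nonneg[of t] t s by simp
      also have "\<dots> = \<bar>t - e\<bar> ^ j * \<bar>poly Q t\<bar>" by (simp add: Q(1) abs_mult power_abs)
      also have "\<dots> \<ge> (s / 2) ^ j * c"
      proof (rule mult_mono)
        show "(s / 2) ^ j \<le> \<bar>t - e\<bar> ^ j" unfolding abs\<sigma> using t s by (intro power_mono) auto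
        have "t \<noteq> e" using t s by auto
        moreover have "dist t e < \<eta>" using t s abs\<sigma>[of t] by (simp add: dist_real_def)
        ultimately show "c \<le> \<bar>poly Q t\<bar>" using \<eta>(2)[of t] by simp
      qed (use c in auto)
      finally show "c * (s / 2) ^ j \<le> poly P t" by (simp add: mult.commute)
    qed (use s c in auto)
    finally show ?thesis .
  qed
  \<comment> \<open>At the heights \<open>1 / (r * Suc k)\<close> the factor
    \<open>Suc k ^ m\<close> cancels the decay in \<open>E_ge\<close>, so the sequence stays above
    the constant \<open>c (1 / (2 r))^m\<close>, against its lower limit 0.\<close>
  have "(\<lambda>k. 1 / r * (1 / real (Suc k))) \<longlonglongrightarrow> 1 / r * 0"
    by (intro tendsto_mult tendsto_const LIMSEQ_Suc lim_1_over_n)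
  then have "\<forall>\<^sub>F k in sequentially. 1 / r * (1 / real (Suc k)) < min d (min \<eta> 1)"
    by (rule order_tendstoD) (use d \<eta> in simp)
  then have "\<forall>\<^sub>F k in sequentially. ennreal (c * (1 / (2 * r)) ^ m) \<le> ennreal (real (Suc k) ^ m) * E (1 / (r * real (Suc k)))"
  proof eventually_elim
    case (elim k)
    have "c * (1 / (2 * r)) ^ m = real (Suc k) ^ m * (c * (1 / (r * real (Suc k)) / 2) ^ m)"
      by (simp add: power_divide power_mult_distrib)
    then have "ennreal (c * (1 / (2 * r)) ^ m) = ennreal (real (Suc k) ^ m) * ennreal (c * (1 / (r * real (Suc k)) / 2) ^ m)"
      using c r by (simp add: ennreal_mult[symmetric] del: of_nat_Suc)
    also have "\<dots> \<le> ennreal (real (Suc k) ^ m) * E (1 / (r * real (Suc k)))"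
      using elim r by (intro mult_left_mono E_ge) auto
    finally show ?case .
  qed
  then have "ennreal (c * (1 / (2 * r)) ^ m) \<le> 0"
    unfolding lim[symmetric] by (rule Liminf_bounded)
  moreover have "c * (1 / (2 * r)) ^ m > 0" using c r by simp
  ultimately show False by (metis ennreal_eq_0_iff le_zero_eq not_le)
qed

text \<open>The two powers are coprime and their product already has degree \<open>2 * m\<close>, so
  the cofactor is constant.\<close>

lemma poly_eq_smult_two_powers:
  fixes P :: "'a::field poly"
  assumes "[:- a, 1:] ^ m dvd P" "[:- b, 1:] ^ m dvd P" "a \<noteq> b" "degree P \<le> 2 * m"
  shows "\<exists>k. P = smult k ([:- a, 1:] ^ m * [:- b, 1:] ^ m)"
proof (cases "P = 0")
  case True
  then show ?thesis by (intro exI[of _ 0]) simp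
next
  case False
  obtain Q where Q: "P = [:- a, 1:] ^ m * Q" using assms(1) by (auto elim: dvdE)
  have Q0: "Q \<noteq> 0" using False Q by auto
  have "m \<le> order b P" using assms(2) False by (simp add: order_divides)
  also have "\<dots> = order b ([:- a, 1:] ^ m) + order b Q" using False Q by (simp add: order_mult)
  also have "order b ([:- a, 1:] ^ m) = 0" using assms(3) by (intro order_0I) simp
  finally have "[:- b, 1:] ^ m dvd Q" by (simp add: order_divides)
  then obtain W where W: "Q = [:- b, 1:] ^ m * W" by (auto elim: dvdE)
  have "W \<noteq> 0" using Q0 W by auto
  then have "degree P = m + (m + degree W)"
    using False by (simp add: Q W degree_mult_eq degree_power_eq)
  then have "degree W = 0" using assms(4) by simp
  then obtain k where "W = [:k:]" by (auto elim: degree_eq_zeroE)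
  then show ?thesis by (intro exI[of _ k]) (simp add: Q W)
qed

section \<open>Integrals over slabs\<close>

text \<open>The weight is, up to a constant, the section volume of the unit ball in dimension
  \<open>2 * m + 1\<close>, and also the section polynomial of \<open>D\<close> after rescaling its
  interval to (-1, 1).\<close>

definition bump_integral :: "nat \<Rightarrow> (real \<Rightarrow> real) \<Rightarrow> real" where
  "bump_integral m g = (LINT \<tau>:{-1<..<1}|lborel. (1 - \<tau>\<^sup>2) ^ m * g \<tau>)"

context bounded_nonempty
begin

definition slab_center :: "'a \<Rightarrow> real" where
  "slab_center y = (H y - H (- y)) / 2"

definition slab_radius :: "'a \<Rightarrow> real" where
  "slab_radius y = (H y + H (- y)) / 2"

text \<open>The leading factor of the section polynomial is unknown and depends on \<open>y\<close>.
  The test function 1 expresses it through the volume of \<open>D\<close>; cross-multiplying with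
  the integral of the weight then removes it without a division.\<close>

lemma slab_formula:
  assumes D: "open D" "connected D" and y: "y \<noteq> 0"
    and P: "degree P \<le> 2 * m" "\<And>t. hyperplane (y /\<^sub>R norm y) t \<inter> D \<noteq> {} \<Longrightarrow> section_volume D (y /\<^sub>R norm y) t = poly P t"
    and lim1: "liminf (\<lambda>k. ennreal (real (Suc k) ^ m) * emeasure lborel {x \<in> D. H y - 1 / real (Suc k) < x \<bullet> y}) = 0"
    and lim2: "liminf (\<lambda>k. ennreal (real (Suc k) ^ m) * emeasure lborel {x \<in> D. H (- y) - 1 / real (Suc k) < x \<bullet> (- y)}) = 0"
    and g [measurable]: "g \<in> borel_measurable borel"
  shows "(LINT x:D|lborel. g (x \<bullet> y)) * bump_integral m (\<lambda>_. 1)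
    = measure lborel D * bump_integral m (\<lambda>\<tau>. g (slab_center y + slab_radius y * \<tau>))"
proof -
  have [measurable]: "D \<in> sets borel" using D(1) by simp
  define r where "r = norm y"
  define \<omega> where "\<omega> = y /\<^sub>R norm y"
  define u where "u = H \<omega>"
  define l where "l = - H (- \<omega>)"
  have r: "r > 0" using y by (simp add: r_def)
  have \<omega>: "norm \<omega> = 1" using y by (simp add: \<omega>_def)
  have "\<omega> \<noteq> 0" using \<omega> by auto
  have y_eq: "y = r *\<^sub>R \<omega>" using y by (simp add: r_def \<omega>_def)
  have xy: "x \<bullet> y = r * (x \<bullet> \<omega>)" "x \<bullet> (- y) = r * (x \<bullet> (- \<omega>))" for x
    by (simp_all add: y_eq)
  have Hy: "H y = r * u" "H (- y) = - (r * l)"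
    using support_scale[OF r, of \<omega>] support_scale[OF r, of "- \<omega>"] by (auto simp: y_eq u_def l_def)
  have lu: "l < x \<bullet> \<omega>" "x \<bullet> \<omega> < u" if "x \<in> D" for x
    using inner_less_support[OF D(1) that, of \<omega>] inner_less_support[OF D(1) that, of "- \<omega>"] \<open>\<omega> \<noteq> 0\<close>
    by (auto simp: u_def l_def)
  then have "l < u" using nonempty_D by fastforce
  \<comment> \<open>The polynomial cut off to the open interval. It equals the section volume for
    every \<open>t\<close>: inside by connectedness, and at the end points because the extreme
    hyperplanes miss the open set \<open>D\<close>.\<close>
  define \<phi> where "\<phi> = (\<lambda>t. indicator {l<..<u} t * poly P t)"
  have V: "section_volume D \<omega> t = \<phi> t" for t
  proof (cases "l < t \<and> t < u")
    case True
    then obtain x where "x \<in> D" "\<omega> \<bullet> x = t" using connected_slices[OF D(2), of \<omega> t] by (auto simp: u_def l_def)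
    then have "hyperplane \<omega> t \<inter> D \<noteq> {}" by (auto simp: hyperplane_def)
    then show ?thesis using P(2) True by (simp add: \<phi>_def \<omega>_def)
  next
    case False
    then have "D \<inter> hyperplane \<omega> t = {}" using lu by (auto simp: hyperplane_def inner_commute)
    then show ?thesis using False by (auto simp: \<phi>_def section_volume_def)
  qed
  have P0: "poly P t \<ge> 0" if "l < t" "t < u" for t
    using V[of t, symmetric] that by (simp add: \<phi>_def section_volume_def)
  have [measurable]: "\<phi> \<in> borel_measurable borel"
    unfolding \<phi>_def by (intro borel_measurable_times borel_measurable_indicator borel_measurable_continuous_onI continuous_intros) simp
  have slab_ge: "ennreal (c * (b - a)) \<le> emeasure lborel {x\<in>D. \<omega> \<bullet> x \<in> {a<..<b}}"
    if "l \<le> a" "a < b" "b \<le> u" "c \<ge> 0" "\<And>t. a < t \<Longrightarrow> t < b \<Longrightarrow> c \<le> poly P t" for a b c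
  proof -
    have "ennreal (c * (b - a)) = (\<integral>\<^sup>+t. ennreal c * indicator {a<..<b} t \<partial>lborel)"
      using that by (subst nn_integral_cmult_indicator) (auto simp: ennreal_mult)
    also have "\<dots> \<le> (\<integral>\<^sup>+t. ennreal (section_volume D \<omega> t) * indicator {a<..<b} t \<partial>lborel)"
      using that unfolding V \<phi>_def by (intro nn_integral_mono) (auto simp: indicator_def intro!: ennreal_leI)
    also have "\<dots> = emeasure lborel {x\<in>D. \<omega> \<bullet> x \<in> {a<..<b}}"
      by (rule emeasure_slab_eq[symmetric]) (use \<omega> bounded_D in auto)
    finally show ?thesis .
  qed
  \<comment> \<open>Heights measured along \<open>y\<close> are \<open>r\<close> times those along
    the unit vector \<omega>, so a cap of height \<open>1 / Suc k\<close> for \<open>y\<close> has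
    height \<open>1 / (r * Suc k)\<close> for \<omega>.\<close>
  have "[:- u, 1:] ^ m dvd P"
  proof (rule power_dvd_of_cap_liminf[where \<sigma>="-1" and d="u - l" and E="\<lambda>s. emeasure lborel {x\<in>D. u - s < x \<bullet> \<omega>}", OF r])
    have "{x \<in> D. u - 1 / (r * real (Suc k)) < x \<bullet> \<omega>} = {x \<in> D. H y - 1 / real (Suc k) < x \<bullet> y}" for k
    proof -
      have "(u - 1 / (r * real (Suc k)) < x \<bullet> \<omega>) = (r * (u - 1 / (r * real (Suc k))) < r * (x \<bullet> \<omega>))" for x
        using r by simp
      then show ?thesis using r by (simp add: Hy xy right_diff_distrib del: of_nat_Suc inner_minus_right)
    qed
    then show "liminf (\<lambda>k. ennreal (real (Suc k) ^ m) * emeasure lborel {x \<in> D. u - 1 / (r * real (Suc k)) < x \<bullet> \<omega>}) = 0"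
      using lim1 by simp
  next
    fix s c :: real assume s: "0 < s" "s < u - l" "c \<ge> 0" and le: "\<And>t. s / 2 < - 1 * (t - u) \<Longrightarrow> - 1 * (t - u) < s \<Longrightarrow> c \<le> poly P t"
    have "ennreal (c * ((u - s / 2) - (u - s))) \<le> emeasure lborel {x\<in>D. \<omega> \<bullet> x \<in> {u - s<..<u - s / 2}}"
      using s by (intro slab_ge le) auto
    also have "\<dots> \<le> emeasure lborel {x\<in>D. u - s < x \<bullet> \<omega>}"
      by (intro emeasure_mono) (auto simp: inner_commute)
    finally show "ennreal (c * (s / 2)) \<le> emeasure lborel {x\<in>D. u - s < x \<bullet> \<omega>}" by simp
  qed (use \<open>l < u\<close> P0 in auto)
  moreover have "[:- l, 1:] ^ m dvd P"
  proof (rule power_dvd_of_cap_liminf[where \<sigma>="1" and d="u - l" and E="\<lambda>s. emeasure lborel {x\<in>D. - l - s < x \<bullet> (- \<omega>)}", OF r])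
    have "{x \<in> D. - l - 1 / (r * real (Suc k)) < x \<bullet> (- \<omega>)} = {x \<in> D. H (- y) - 1 / real (Suc k) < x \<bullet> (- y)}" for k
    proof -
      have "(- l - 1 / (r * real (Suc k)) < x \<bullet> (- \<omega>)) = (r * (- l - 1 / (r * real (Suc k))) < r * (x \<bullet> (- \<omega>)))" for x
        using r by (subst mult_less_cancel_left_pos) auto
      then show ?thesis using r by (simp add: Hy xy right_diff_distrib del: of_nat_Suc inner_minus_right)
    qed
    then show "liminf (\<lambda>k. ennreal (real (Suc k) ^ m) * emeasure lborel {x \<in> D. - l - 1 / (r * real (Suc k)) < x \<bullet> (- \<omega>)}) = 0"
      using lim2 by simp
  next
    fix s c :: real assume s: "0 < s" "s < u - l" "c \<ge> 0" and le: "\<And>t. s / 2 < 1 * (t - l) \<Longrightarrow> 1 * (t - l) < s \<Longrightarrow> c \<le> poly P t"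
    have "ennreal (c * ((l + s) - (l + s / 2))) \<le> emeasure lborel {x\<in>D. \<omega> \<bullet> x \<in> {l + s / 2<..<l + s}}"
      using s by (intro slab_ge le) auto
    also have "\<dots> \<le> emeasure lborel {x\<in>D. - l - s < x \<bullet> (- \<omega>)}"
      by (intro emeasure_mono) (auto simp: inner_commute)
    finally show "ennreal (c * (s / 2)) \<le> emeasure lborel {x\<in>D. - l - s < x \<bullet> (- \<omega>)}" by simp
  qed (use \<open>l < u\<close> P0 in auto)
  ultimately obtain k where k: "P = smult k ([:- u, 1:] ^ m * [:- l, 1:] ^ m)"
    using poly_eq_smult_two_powers[of u m P l] \<open>l < u\<close> P(1) by auto
  \<comment> \<open>The substitution \<open>t = c0 + h0 * \<tau>\<close> turns
    \<open>(t - u) * (t - l)\<close> into \<open>- h0^2 * (1 - \<tau>^2)\<close>; \<open>K\<close>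
    collects the constants.\<close>
  define c0 where "c0 = (u + l) / 2"
  define h0 where "h0 = (u - l) / 2"
  have h0: "h0 > 0" using \<open>l < u\<close> by (simp add: h0_def)
  define K where "K = k * (- (h0\<^sup>2)) ^ m"
  have \<phi>_aff: "\<phi> (c0 + h0 * \<tau>) = K * (indicator {-1<..<1} \<tau> * (1 - \<tau>\<^sup>2) ^ m)" for \<tau>
  proof -
    have u_eq: "c0 + h0 * \<tau> - u = h0 * (\<tau> - 1)" and l_eq: "c0 + h0 * \<tau> - l = h0 * (\<tau> + 1)"
      by (auto simp: c0_def h0_def field_simps)
    have "(c0 + h0 * \<tau> < u) = (h0 * (\<tau> - 1) < 0)" "(l < c0 + h0 * \<tau>) = (0 < h0 * (\<tau> + 1))"
      using u_eq l_eq by linarith+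
    then have ind: "indicator {l<..<u} (c0 + h0 * \<tau>) = (indicator {-1<..<1} \<tau> :: real)"
      using h0 by (auto simp: indicator_def zero_less_mult_iff mult_less_0_iff)
    have "poly P (c0 + h0 * \<tau>) = k * ((c0 + h0 * \<tau> - u) * (c0 + h0 * \<tau> - l)) ^ m"
      by (simp add: k poly_power power_mult_distrib)
    also have "(c0 + h0 * \<tau> - u) * (c0 + h0 * \<tau> - l) = - (h0\<^sup>2) * (1 - \<tau>\<^sup>2)"
      unfolding u_eq l_eq by (simp add: power2_eq_square algebra_simps)
    finally have "poly P (c0 + h0 * \<tau>) = k * ((- (h0\<^sup>2)) ^ m * (1 - \<tau>\<^sup>2) ^ m)"
      by (simp only: power_mult_distrib)
    then show ?thesis by (simp add: \<phi>_def ind K_def)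
  qed
  have slab_eq: "r * (c0 + h0 * \<tau>) = slab_center y + slab_radius y * \<tau>" for \<tau>
    by (simp add: slab_center_def slab_radius_def Hy c0_def h0_def field_simps)
  have formula: "(LINT x:D|lborel. f (x \<bullet> y)) = h0 * K * bump_integral m (\<lambda>\<tau>. f (slab_center y + slab_radius y * \<tau>))"
    if [measurable]: "f \<in> borel_measurable borel" for f
  proof -
    have "(LINT x:D|lborel. f (x \<bullet> y)) = (LINT x:D|lborel. (\<lambda>t. f (r * t)) (\<omega> \<bullet> x))"
      by (simp add: y_eq inner_commute)
    also have "\<dots> = (LINT t|lborel. \<phi> t * f (r * t))"
      by (rule integral_slab_eq[OF \<omega> _ bounded_D]) (auto simp: V)
    also have "\<dots> = h0 * (LINT \<tau>|lborel. \<phi> (c0 + h0 * \<tau>) * f (r * (c0 + h0 * \<tau>)))"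
      using h0 lborel_integral_real_affine[of h0 "\<lambda>t. \<phi> t * f (r * t)" c0] by simp
    also have "(\<lambda>\<tau>. \<phi> (c0 + h0 * \<tau>) * f (r * (c0 + h0 * \<tau>))) =
        (\<lambda>\<tau>. K * (indicator {-1<..<1} \<tau> *\<^sub>R ((1 - \<tau>\<^sup>2) ^ m * f (slab_center y + slab_radius y * \<tau>))))"
      by (simp add: \<phi>_aff slab_eq mult.assoc)
    also have "(LINT \<tau>|lborel. \<dots> \<tau>) = K * bump_integral m (\<lambda>\<tau>. f (slab_center y + slab_radius y * \<tau>))"
      by (simp add: bump_integral_def set_lebesgue_integral_def)
    finally show ?thesis by simp
  qed
  \<comment> \<open>The constant test function relates the factor \<open>h0 * K\<close> to the
    volume of \<open>D\<close>.\<close>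
  have "measure lborel D = h0 * K * bump_integral m (\<lambda>_. 1)"
    using formula[of "\<lambda>_. 1"] by (simp add: set_lebesgue_integral_def)
  then show ?thesis by (simp add: formula)
qed

end

section \<open>From almost all vectors to all vectors of the annulus\<close>

lemma AE_lborel_imp_ex_in_open:
  fixes U :: "'a::euclidean_space set"
  assumes "AE y in lborel. P y" "open U" "U \<noteq> {}"
  shows "\<exists>y\<in>U. P y"
proof (rule ccontr)
  assume none: "\<not> ?thesis"
  obtain N where N: "{y \<in> space lborel. \<not> P y} \<subseteq> N" "emeasure lborel N = 0" "N \<in> sets lborel"
    using assms(1) by (rule AE_E)
  obtain x r where "r > 0" "cball x r \<subseteq> U"
    using assms(2,3) open_contains_cball by blast
  then have "cball x r \<subseteq> N" using none N by auto
  then have "emeasure lborel (cball x r) = 0"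
    using emeasure_mono[of "cball x r" N lborel] N by simp
  then show False using emeasure_lborel_cball_pos[OF \<open>r > 0\<close>] by blast
qed

text \<open>Dominated convergence with the maximum of \<open>|g|\<close> on [-M, M] as bound. The
  weight \<open>w\<close> is 1 for the integral over \<open>D\<close> and
  \<open>(1 - \<tau>^2) ^ m\<close> for the bump integral.\<close>

lemma tendsto_set_integral_compose:
  fixes S :: "'a::euclidean_space set" and g :: "real \<Rightarrow> real"
  assumes S [measurable]: "S \<in> sets borel" and "bounded S" and g: "continuous_on UNIV g"
    and w [measurable]: "w \<in> borel_measurable borel" "\<And>x. x \<in> S \<Longrightarrow> \<bar>w x\<bar> \<le> 1"
    and a [measurable]: "\<And>n. a n \<in> borel_measurable borel" "b \<in> borel_measurable borel"
    and bound: "\<And>n x. x \<in> S \<Longrightarrow> \<bar>a n x\<bar> \<le> M"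
    and lim: "\<And>x. x \<in> S \<Longrightarrow> (\<lambda>n. a n x) \<longlonglongrightarrow> b x"
  shows "(\<lambda>n. LINT x:S|lborel. w x * g (a n x)) \<longlonglongrightarrow> (LINT x:S|lborel. w x * g (b x))"
proof -
  have [measurable]: "g \<in> borel_measurable borel"
    using g by (rule borel_measurable_continuous_onI)
  have "compact (g ` {-M..M})"
    by (rule compact_continuous_image[OF continuous_on_subset[OF g]]) auto
  then obtain C where C: "\<And>t. \<bar>t\<bar> \<le> M \<Longrightarrow> \<bar>g t\<bar> \<le> C"
    by (force dest!: compact_imp_bounded simp: bounded_iff abs_le_iff)
  show ?thesis
    unfolding set_lebesgue_integral_def
  proof (rule integral_dominated_convergence[where w="\<lambda>x. C * indicator S x"])
    show "integrable lborel (\<lambda>x. C * indicator S x)"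
      using emeasure_bounded_finite[OF \<open>bounded S\<close>] by (intro integrable_mult_right integrable_real_indicator) auto
    show "AE x in lborel. (\<lambda>n. indicator S x *\<^sub>R (w x * g (a n x))) \<longlonglongrightarrow> indicator S x *\<^sub>R (w x * g (b x))"
    proof (intro AE_I2)
      fix x show "(\<lambda>n. indicator S x *\<^sub>R (w x * g (a n x))) \<longlonglongrightarrow> indicator S x *\<^sub>R (w x * g (b x))"
      proof (cases "x \<in> S")
        case True
        have "(\<lambda>n. g (a n x)) \<longlonglongrightarrow> g (b x)"
          by (rule continuous_on_tendsto_compose[OF g lim[OF True]]) auto
        then show ?thesis by (intro tendsto_intros)
      qed simp
    qed
    show "AE x in lborel. norm (indicator S x *\<^sub>R (w x * g (a n x))) \<le> C * indicator S x" for n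
    proof (intro AE_I2)
      fix x show "norm (indicator S x *\<^sub>R (w x * g (a n x))) \<le> C * indicator S x"
      proof (cases "x \<in> S")
        case True
        then have "\<bar>w x\<bar> * \<bar>g (a n x)\<bar> \<le> 1 * C" using w(2) C bound by (intro mult_mono) auto
        then show ?thesis using True by (simp add: abs_mult)
      qed simp
    qed
  qed measurable
qed

text \<open>For continuous \<open>g\<close> both sides are continuous in \<open>y\<close>, because
  the support function is. As a null set contains no ball, \<open>y\<close> is a limit of points of
  \<open>A\<close> at which the formula holds.\<close>

lemma (in bounded_nonempty) slab_formula_extend:
  assumes "open D" "open A" "bounded A" "y \<in> A" and g: "continuous_on UNIV g"
    and AE: "AE y in lborel. y \<in> A \<longrightarrow> (LINT x:D|lborel. g (x \<bullet> y)) * bump_integral m (\<lambda>_. 1)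
      = measure lborel D * bump_integral m (\<lambda>\<tau>. g (slab_center y + slab_radius y * \<tau>))"
  shows "(LINT x:D|lborel. g (x \<bullet> y)) * bump_integral m (\<lambda>_. 1)
      = measure lborel D * bump_integral m (\<lambda>\<tau>. g (slab_center y + slab_radius y * \<tau>))"
proof -
  have [measurable]: "D \<in> sets borel" using assms(1) by simp
  have "\<exists>z\<in>A \<inter> ball y (inverse (real (Suc n))). z \<in> A \<longrightarrow> (LINT x:D|lborel. g (x \<bullet> z)) * bump_integral m (\<lambda>_. 1)
      = measure lborel D * bump_integral m (\<lambda>\<tau>. g (slab_center z + slab_radius z * \<tau>))" for n
  proof (rule AE_lborel_imp_ex_in_open[OF AE])
    have "y \<in> A \<inter> ball y (inverse (real (Suc n)))" using \<open>y \<in> A\<close> by simp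
    then show "A \<inter> ball y (inverse (real (Suc n))) \<noteq> {}" by blast
  qed (use assms(2) in auto)
  then obtain z where zA: "\<And>n. z n \<in> A" and zb: "\<And>n. dist y (z n) < inverse (real (Suc n))"
    and zf: "\<And>n. (LINT x:D|lborel. g (x \<bullet> z n)) * bump_integral m (\<lambda>_. 1)
      = measure lborel D * bump_integral m (\<lambda>\<tau>. g (slab_center (z n) + slab_radius (z n) * \<tau>))"
    by (metis Int_iff mem_ball)
  have z: "z \<longlonglongrightarrow> y"
  proof (rule metric_LIMSEQ_I)
    fix e :: real assume "e > 0"
    then obtain n0 where n0: "inverse (real (Suc n0)) < e" using reals_Archimedean by blast
    have "dist (z n) y < e" if "n \<ge> n0" for n
    proof -
      have "inverse (real (Suc n)) \<le> inverse (real (Suc n0))" using that by (intro le_imp_inverse_le) auto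
      then show ?thesis using zb[of n] n0 unfolding dist_commute[of "z n"] by linarith
    qed
    then show "\<exists>no. \<forall>n\<ge>no. dist (z n) y < e" by blast
  qed
  obtain K where K: "\<And>x. x \<in> D \<Longrightarrow> norm x \<le> K" using bounded_D by (auto simp: bounded_iff)
  have K0: "K \<ge> 0" using K nonempty_D norm_ge_zero order_trans by blast
  obtain J where J: "\<And>x. x \<in> A \<Longrightarrow> norm x \<le> J" using assms(3) by (auto simp: bounded_iff)
  have Hlim: "(\<lambda>n. H (z n)) \<longlonglongrightarrow> H y" "(\<lambda>n. H (- z n)) \<longlonglongrightarrow> H (- y)"
    by (intro continuous_on_tendsto_compose[OF continuous_support[of UNIV]] tendsto_minus z; simp)+
  have inner_le: "\<bar>x \<bullet> v\<bar> \<le> K * J" if "x \<in> D" "norm v \<le> J" for x v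
    using Cauchy_Schwarz_ineq2[of x v] mult_mono[OF K[OF that(1)] that(2)] K0 by (force intro: order_trans)
  have Hbound: "\<bar>H v\<bar> \<le> K * J" if "norm v \<le> J" for v
  proof -
    obtain x where "x \<in> D" using nonempty_D by blast
    then have "- (K * J) \<le> H v" using inner_le_support[of x v] inner_le[of x v] that by (simp add: abs_le_iff)
    moreover have "H v \<le> K * J" using inner_le[OF _ that] by (intro support_leI) (auto simp: abs_le_iff)
    ultimately show ?thesis by simp
  qed
  have "(\<lambda>n. LINT x:D|lborel. 1 * g (x \<bullet> z n)) \<longlonglongrightarrow> (LINT x:D|lborel. 1 * g (x \<bullet> y))"
    by (rule tendsto_set_integral_compose[where M="K * J"])
      (use bounded_D g z inner_le zA J in \<open>auto intro!: tendsto_intros\<close>)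
  moreover have "(\<lambda>n. bump_integral m (\<lambda>\<tau>. g (slab_center (z n) + slab_radius (z n) * \<tau>)))
      \<longlonglongrightarrow> bump_integral m (\<lambda>\<tau>. g (slab_center y + slab_radius y * \<tau>))"
    unfolding bump_integral_def
  proof (rule tendsto_set_integral_compose[where M="2 * (K * J)" and w="\<lambda>\<tau>. (1 - \<tau>\<^sup>2) ^ m" and g=g
        and a="\<lambda>n \<tau>. slab_center (z n) + slab_radius (z n) * \<tau>" and b="\<lambda>\<tau>. slab_center y + slab_radius y * \<tau>"])
    fix n and x :: real assume x: "x \<in> {-1<..<1}"
    have "\<bar>slab_radius (z n) * x\<bar> \<le> \<bar>slab_radius (z n)\<bar> * 1"
      using x unfolding abs_mult by (intro mult_left_mono) auto
    moreover have "\<bar>H (z n)\<bar> \<le> K * J" "\<bar>H (- z n)\<bar> \<le> K * J"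
      using J[OF zA[of n]] by (auto intro!: Hbound)
    then have "\<bar>slab_center (z n)\<bar> \<le> K * J" "\<bar>slab_radius (z n)\<bar> \<le> K * J"
      by (simp_all add: slab_center_def slab_radius_def abs_le_iff)
    ultimately show "\<bar>slab_center (z n) + slab_radius (z n) * x\<bar> \<le> 2 * (K * J)"
      by linarith
  next
    fix x :: real assume x: "x \<in> {-1<..<1}"
    then have "x\<^sup>2 \<le> 1" by (simp add: abs_square_le_1 abs_le_iff)
    then show "\<bar>(1 - x\<^sup>2) ^ m\<bar> \<le> 1" by (simp add: power_le_one_iff power_abs power_le_one)
    show "(\<lambda>n. slab_center (z n) + slab_radius (z n) * x) \<longlonglongrightarrow> slab_center y + slab_radius y * x"
      unfolding slab_center_def slab_radius_def by (intro tendsto_intros Hlim) auto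
  qed (use g in auto)
  ultimately have "(\<lambda>n. (LINT x:D|lborel. g (x \<bullet> z n)) * bump_integral m (\<lambda>_. 1)) \<longlonglongrightarrow> (LINT x:D|lborel. g (x \<bullet> y)) * bump_integral m (\<lambda>_. 1)"
    and "(\<lambda>n. measure lborel D * bump_integral m (\<lambda>\<tau>. g (slab_center (z n) + slab_radius (z n) * \<tau>)))
      \<longlonglongrightarrow> measure lborel D * bump_integral m (\<lambda>\<tau>. g (slab_center y + slab_radius y * \<tau>))"
    by (auto intro!: tendsto_intros)
  then show ?thesis unfolding zf by (rule LIMSEQ_unique)
qed

section \<open>Quadratic forms and moments\<close>

text \<open>Gram-Schmidt for the form \<open>b\<close>: a \<open>b\<close>-orthonormal family is
  enlarged to one of full size, and \<open>T\<close> sends the standard basis to it.\<close>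

lemma positive_definite_form_isometric:
  fixes b :: "'a::euclidean_space \<Rightarrow> 'a \<Rightarrow> real"
  assumes lin: "\<And>z. linear (\<lambda>y. b y z)" and sym: "\<And>y z. b y z = b z y" and pos: "\<And>y. y \<noteq> 0 \<Longrightarrow> b y y > 0"
  shows "\<exists>T::'a \<Rightarrow> 'a. linear T \<and> bij T \<and> (\<forall>u. b (T u) (T u) = (norm u)\<^sup>2)"
proof -
  have b_add: "b (x + y) z = b x z + b y z" and b_scale: "b (r *\<^sub>R y) z = r * b y z" for x y z r
    using linear_add[OF lin] linear_cmul[OF lin] by auto
  have b_sum: "b (\<Sum>i\<in>I. f i) z = (\<Sum>i\<in>I. b (f i) z)" for I :: "'a set" and f z
    using linear_sum[OF lin] by auto
  have b0: "b 0 z = 0" for z using b_scale[of 0 0 z] by simp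
  have ex: "\<exists>F. finite F \<and> card F = k \<and> (\<forall>f\<in>F. \<forall>g\<in>F. b f g = (if f = g then 1 else 0))" if "k \<le> DIM('a)" for k
    using that
  proof (induction k)
    case 0
    show ?case by (intro exI[of _ "{}"]) simp
  next
    case (Suc k)
    then obtain F where F: "finite F" "card F = k" "\<And>f g. f \<in> F \<Longrightarrow> g \<in> F \<Longrightarrow> b f g = (if f = g then 1 else 0)"
      by auto
    \<comment> \<open>The \<open>b\<close>-orthogonal projection onto the span of \<open>F\<close>.
      As it is not surjective it has a nonzero kernel vector, which is \<open>b\<close>-orthogonal
      to \<open>F\<close> and is normalised to the next member.\<close>
    define \<psi> where "\<psi> = (\<lambda>y. \<Sum>f\<in>F. b y f *\<^sub>R f)"
    have lin\<psi>: "linear \<psi>"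
      by (rule linearI) (simp_all add: \<psi>_def b_add b_scale scaleR_add_left sum.distrib scaleR_sum_right)
    have "range \<psi> \<subseteq> span F" by (auto simp: \<psi>_def intro: span_sum span_scale span_base)
    moreover have "span F \<noteq> UNIV"
    proof
      assume "span F = UNIV"
      then have "DIM('a) \<le> card F" using dim_le_card'[OF F(1)] by (metis dim_UNIV dim_span)
      then show False using Suc.prems F(2) by simp
    qed
    ultimately have "\<not> surj \<psi>" by auto
    then have "\<not> inj \<psi>" using linear_injective_imp_surjective[OF lin\<psi>] by blast
    then obtain y where y: "y \<noteq> 0" "\<psi> y = 0" using linear_injective_0[OF lin\<psi>] by blast
    have yF: "b y f = 0" if "f \<in> F" for f
    proof -
      have "b (\<psi> y) f = (\<Sum>g\<in>F. b y g * b g f)" by (simp add: \<psi>_def b_sum b_scale)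
      also have "\<dots> = (\<Sum>g\<in>F. if g = f then b y f else 0)" using F(3) that by (intro sum.cong) auto
      also have "\<dots> = b y f" using F(1) that by simp
      finally show ?thesis using y b0 by simp
    qed
    define z where "z = (1 / sqrt (b y y)) *\<^sub>R y"
    have zz: "b z z = 1"
    proof -
      have "b z z = (1 / sqrt (b y y)) * b z y" using b_scale[of "1 / sqrt (b y y)" y z] sym[of y z] by (simp add: z_def)
      also have "b z y = (1 / sqrt (b y y)) * b y y" by (simp add: z_def b_scale)
      finally show ?thesis using pos[OF y(1)] by simp
    qed
    have zF: "b z f = 0" "b f z = 0" if "f \<in> F" for f
      using yF[OF that] sym[of f z] by (simp_all add: z_def b_scale)
    have "z \<notin> F" using zz zF(1)[of z] by auto
    have "b f g = (if f = g then 1 else 0)" if "f \<in> insert z F" "g \<in> insert z F" for f g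
    proof (cases "f = z"; cases "g = z")
      assume "f \<noteq> z" "g \<noteq> z"
      then show ?thesis using that F(3)[of f g] by simp
    qed (use that zz zF in auto)
    moreover have "card (insert z F) = Suc k" using \<open>z \<notin> F\<close> F(1,2) by simp
    ultimately show ?case using F(1) by (metis finite_insert)
  qed
  obtain F where F: "finite F" "card F = DIM('a)" "\<And>f g. f \<in> F \<Longrightarrow> g \<in> F \<Longrightarrow> b f g = (if f = g then 1 else 0)"
    using ex[of "DIM('a)"] by auto
  obtain \<pi> where \<pi>: "bij_betw \<pi> (Basis :: 'a set) F"
    using finite_same_card_bij[OF finite_Basis F(1)] F(2) by auto
  define T where "T = (\<lambda>u. \<Sum>i\<in>Basis. (u \<bullet> i) *\<^sub>R \<pi> i)"
  have linT: "linear T"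
    by (rule linearI) (simp_all add: T_def inner_add_left scaleR_add_left sum.distrib scaleR_sum_right)
  have iso: "b (T u) (T u) = (norm u)\<^sup>2" for u
  proof -
    have bT: "b (T u) z = (\<Sum>i\<in>Basis. (u \<bullet> i) * b (\<pi> i) z)" for z
      by (simp add: T_def b_sum b_scale)
    have "b (\<pi> i) (T u) = u \<bullet> i" if "i \<in> Basis" for i
    proof -
      have "b (\<pi> i) (T u) = (\<Sum>j\<in>Basis. (u \<bullet> j) * b (\<pi> j) (\<pi> i))" using bT sym by metis
      also have "\<dots> = (\<Sum>j\<in>Basis. if j = i then u \<bullet> i else 0)"
      proof (intro sum.cong refl)
        fix j :: 'a assume j: "j \<in> Basis"
        have "(\<pi> j = \<pi> i) = (j = i)" using \<pi> j that by (auto simp: bij_betw_def dest: inj_onD)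
        moreover have "\<pi> j \<in> F" "\<pi> i \<in> F" using \<pi> j that by (auto simp: bij_betw_def)
        ultimately show "(u \<bullet> j) * b (\<pi> j) (\<pi> i) = (if j = i then u \<bullet> i else 0)" using F(3)[of "\<pi> j" "\<pi> i"] by simp
      qed
      finally show ?thesis using that by simp
    qed
    then have "b (T u) (T u) = (\<Sum>i\<in>Basis. (u \<bullet> i) * (u \<bullet> i))" unfolding bT by simp
    then show ?thesis by (simp add: power2_norm_eq_inner euclidean_inner[of u u])
  qed
  have "inj T"
    unfolding linear_injective_0[OF linT]
  proof (intro allI impI)
    fix u assume "T u = 0"
    then show "u = 0" using iso[of u] b0 by simp
  qed
  then have "bij T" using linear_injective_imp_surjective[OF linT] by (simp add: bij_def)
  then show ?thesis using linT iso by (intro exI[of _ T]) simp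
qed

text \<open>The section at height \<open>t\<close> is a ball of radius \<open>sqrt (1 - t^2)\<close>
  in dimension \<open>2 * m\<close>. Heights of modulus 1 are excluded because for
  \<open>m = 0\<close> the section there is a point of measure 1, whereas the right-hand side is
  0.\<close>

lemma section_volume_cball:
  fixes \<omega> :: "'a::euclidean_space"
  assumes \<omega>: "norm \<omega> = 1" and dim: "DIM('a) = 2 * m + 1" and t: "\<bar>t\<bar> \<noteq> 1"
  shows "section_volume (cball 0 1) \<omega> t = unit_ball_vol (real (2 * m)) * (indicator {-1<..<1} t * (1 - t\<^sup>2) ^ m)"
proof -
  define B where "B = hyperplane_basis \<omega>"
  note B = hyperplane_basis_props[OF \<omega>, folded B_def] and coords = hyperplane_coords[OF \<omega>, folded B_def]
  have [measurable]: "hyperplane \<omega> t \<in> sets borel"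
    unfolding hyperplane_def by (intro borel_closed closed_hyperplane)
  have mem: "(t *\<^sub>R \<omega> + (\<Sum>b\<in>B. c b *\<^sub>R b) \<in> cball 0 1 \<inter> hyperplane \<omega> t) = (t\<^sup>2 + (\<Sum>b\<in>B. (c b)\<^sup>2) \<le> 1)" for c
    using coords[of t c] abs_square_le_1[of "norm (t *\<^sub>R \<omega> + (\<Sum>b\<in>B. c b *\<^sub>R b))"] by (simp add: hyperplane_def inner_commute)
  have em: "emeasure (hyperplane_lborel \<omega> t) (cball 0 1 \<inter> hyperplane \<omega> t) =
      emeasure (\<Pi>\<^sub>M b\<in>B. (lborel :: real measure)) {c \<in> B \<rightarrow>\<^sub>E UNIV. t\<^sup>2 + (\<Sum>b\<in>B. (c b)\<^sup>2) \<le> 1}"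
    using emeasure_hyperplane_lborel[of "cball 0 1 \<inter> hyperplane \<omega> t" \<omega> t, folded B_def] by (simp only: mem) simp
  show ?thesis
  proof (cases "\<bar>t\<bar> < 1")
    case True
    define r where "r = sqrt (1 - t\<^sup>2)"
    have "t\<^sup>2 < 1" using True by (simp add: abs_square_less_1)
    then have r: "r > 0" "r\<^sup>2 = 1 - t\<^sup>2" by (auto simp: r_def)
    have "{c \<in> B \<rightarrow>\<^sub>E UNIV. t\<^sup>2 + (\<Sum>b\<in>B. (c b)\<^sup>2) \<le> 1} =
        {f. sqrt (\<Sum>i\<in>B. (f i)\<^sup>2) \<le> r} \<inter> space (Pi\<^sub>M B (\<lambda>_. lborel :: real measure))"
      by (auto simp: r_def space_PiM)
    then have "emeasure (hyperplane_lborel \<omega> t) (cball 0 1 \<inter> hyperplane \<omega> t) = ennreal (unit_ball_vol (real (2 * m)) * r ^ (2 * m))"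
      using em emeasure_cball_aux[OF B(1) r(1)] B(5) by (simp add: dim)
    moreover have "indicator {-1<..<1} t = (1::real)" using True by (auto simp: indicator_def abs_less_iff)
    moreover have "0 \<le> unit_ball_vol (2 * real m) * (1 - t\<^sup>2) ^ m"
      using \<open>t\<^sup>2 < 1\<close> unit_ball_vol_nonneg[of "2 * real m"] by (intro mult_nonneg_nonneg) auto
    ultimately show ?thesis
      using r by (simp add: section_volume_def measure_def power_mult)
  next
    case False
    then have "1 < \<bar>t\<bar>" using t by simp
    then have "1 < t\<^sup>2" using abs_square_le_1[of t] by linarith
    then have "{c \<in> B \<rightarrow>\<^sub>E UNIV. t\<^sup>2 + (\<Sum>b\<in>B. (c b)\<^sup>2) \<le> 1} = {}"
      using sum_nonneg[of B "\<lambda>b. (c b)\<^sup>2" for c] by (smt (verit) Collect_empty_eq sum_nonneg zero_le_power2)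
    then have "emeasure (hyperplane_lborel \<omega> t) (cball 0 1 \<inter> hyperplane \<omega> t) = 0" by (simp only: em emeasure_empty)
    moreover have "t \<notin> {-1<..<1}" using \<open>1 < \<bar>t\<bar>\<close> by auto
    ultimately show ?thesis by (simp add: section_volume_def measure_def)
  qed
qed

text \<open>The model case, used backwards: it rewrites a bump integral of exponentials as an
  exponential integral over the unit ball.\<close>

lemma integral_cball_inner:
  fixes y :: "'a::euclidean_space"
  assumes dim: "DIM('a) = 2 * m + 1" and [measurable]: "g \<in> borel_measurable borel"
  shows "(LINT x:cball 0 1|lborel. g (x \<bullet> y)) = unit_ball_vol (real (2 * m)) * bump_integral m (\<lambda>\<tau>. g (norm y * \<tau>))"
proof -
  obtain \<omega> :: 'a where \<omega>: "norm \<omega> = 1" "y = norm y *\<^sub>R \<omega>"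
  proof (cases "y = 0")
    case True
    obtain i :: 'a where "i \<in> Basis" using nonempty_Basis by blast
    then show ?thesis using that[of i] True by simp
  next
    case False
    then show ?thesis using that[of "sgn y"] by (simp add: norm_sgn sgn_div_norm)
  qed
  have "(LINT x:cball 0 1|lborel. g (x \<bullet> y)) = (LINT x:cball 0 1|lborel. (\<lambda>t. g (norm y * t)) (\<omega> \<bullet> x))"
    by (subst \<omega>(2)) (simp add: inner_commute)
  also have "\<dots> = (LINT t|lborel. unit_ball_vol (real (2 * m)) * (indicator {-1<..<1} t * (1 - t\<^sup>2) ^ m) * g (norm y * t))"
  proof (rule integral_slab_eq[OF \<omega>(1)])
    have "AE t in lborel. t \<noteq> 1 \<and> t \<noteq> (-1 :: real)"
      using AE_lborel_singleton[of "1::real"] AE_lborel_singleton[of "-1::real"] by eventually_elim simp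
    then show "AE t in lborel. section_volume (cball 0 1) \<omega> t = unit_ball_vol (real (2 * m)) * (indicator {-1<..<1} t * (1 - t\<^sup>2) ^ m)"
      by eventually_elim (rule section_volume_cball[OF \<omega>(1) dim], auto simp: abs_if split: if_splits)
  qed auto
  also have "\<dots> = unit_ball_vol (real (2 * m)) * bump_integral m (\<lambda>\<tau>. g (norm y * \<tau>))"
    by (simp add: bump_integral_def set_lebesgue_integral_def mult.assoc)
  finally show ?thesis .
qed

section \<open>Integrals of continuous functions and moments of the bump weight\<close>

lemma set_integrable_continuous_bounded:
  fixes f :: "'a::euclidean_space \<Rightarrow> 'b::euclidean_space"
  assumes "S \<in> sets borel" "bounded S" "continuous_on UNIV f"
  shows "set_integrable lborel S f"
proof -
  have "set_integrable lborel (closure S) f"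
    unfolding set_integrable_def
    using assms by (intro borel_integrable_compact) (auto intro: continuous_on_subset)
  then show ?thesis
    by (rule set_integrable_subset) (use assms(1) closure_subset in auto)
qed

lemma set_integral_pos:
  fixes f :: "'a::euclidean_space \<Rightarrow> real"
  assumes S: "S \<in> sets borel" "bounded S" and f: "continuous_on UNIV f" "\<And>x. f x \<ge> 0"
    and U: "open U" "U \<subseteq> S" "z \<in> U" "f z > 0"
  shows "(LINT x:S|lborel. f x) > 0"
proof -
  have "open (U \<inter> {x. f z / 2 < f x})"
    using U f by (intro open_Int open_Collect_less continuous_intros) auto
  moreover have "z \<in> U \<inter> {x. f z / 2 < f x}" using U by simp
  ultimately obtain r where r: "r > 0" "cball z r \<subseteq> U \<inter> {x. f z / 2 < f x}"
    using open_contains_cball by blast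
  have "0 < f z / 2 * measure lborel (cball z r)"
    using U(4) content_cball_pos[OF r(1), of z] by simp
  also have "\<dots> = (LINT x:cball z r|lborel. f z / 2)"
    by (simp add: set_lebesgue_integral_def)
  also have "\<dots> \<le> (LINT x:S|lborel. f x)"
    unfolding set_lebesgue_integral_def
  proof (rule integral_mono)
    show "integrable lborel (\<lambda>x. indicat_real (cball z r) x *\<^sub>R (f z / 2))"
      using set_integrable_continuous_bounded[of "cball z r" "\<lambda>_. f z / 2"] by (simp add: set_integrable_def)
    show "integrable lborel (\<lambda>x. indicat_real S x *\<^sub>R f x)"
      using set_integrable_continuous_bounded[OF S f(1)] by (simp add: set_integrable_def)
    show "indicat_real (cball z r) x *\<^sub>R (f z / 2) \<le> indicat_real S x *\<^sub>R f x" for x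
      using r(2) U(2) f(2)[of x] by (fastforce simp: indicator_def)
  qed
  finally show ?thesis .
qed

lemma bump_integrable:
  assumes "continuous_on UNIV g"
  shows "set_integrable lborel {-1<..<1} (\<lambda>\<tau>. (1 - \<tau>\<^sup>2) ^ m * g \<tau> :: real)"
  using assms by (intro set_integrable_continuous_bounded continuous_intros) auto

lemma bump_integral_add:
  assumes "continuous_on UNIV f" "continuous_on UNIV g"
  shows "bump_integral m (\<lambda>\<tau>. f \<tau> + g \<tau>) = bump_integral m f + bump_integral m g"
  using bump_integrable[OF assms(1)] bump_integrable[OF assms(2)]
  by (simp add: bump_integral_def distrib_left set_integral_add)

lemma bump_integral_cmult: "bump_integral m (\<lambda>\<tau>. a * f \<tau>) = a * bump_integral m f"
  by (simp add: bump_integral_def mult.left_commute)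

lemma bump_integral_odd: "bump_integral m (\<lambda>\<tau>. \<tau>) = 0"
proof -
  let ?f = "\<lambda>\<tau>::real. indicator {-1<..<1} \<tau> *\<^sub>R ((1 - \<tau>\<^sup>2) ^ m * \<tau>)"
  have "integral\<^sup>L lborel ?f = (LINT \<tau>|lborel. ?f (0 + (-1) * \<tau>))"
    using lborel_integral_real_affine[of "-1" ?f 0] by simp
  also have "(\<lambda>\<tau>. ?f (0 + (-1) * \<tau>)) = (\<lambda>\<tau>. - ?f \<tau>)"
    by (auto simp: indicator_def)
  finally show ?thesis by (simp add: bump_integral_def set_lebesgue_integral_def)
qed

text \<open>Positivity is required at 1/2 and not at 0 so that the lemma covers the second moment,
  whose integrand vanishes at 0.\<close>

lemma bump_integral_pos:
  assumes "continuous_on UNIV g" "\<And>\<tau>. g \<tau> \<ge> 0" "g (1/2) > 0"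
  shows "bump_integral m g > 0"
proof -
  \<comment> \<open>Outside the interval \<open>(1 - \<tau>^2) ^ m\<close> is negative for odd
    \<open>m\<close>; the truncated weight is nonnegative on the whole line, as
    \<open>set_integral_pos\<close> demands.\<close>
  have "bump_integral m g = (LINT \<tau>:{-1<..<1}|lborel. max 0 (1 - \<tau>\<^sup>2) ^ m * g \<tau>)"
    unfolding bump_integral_def by (rule set_lebesgue_integral_cong) (auto simp: abs_square_le_1 abs_le_iff max_def not_le abs_square_less_1)
  also have "\<dots> > 0"
    by (rule set_integral_pos[where U="{-1<..<1}" and z="1/2"])
      (use assms in \<open>auto intro!: continuous_intros mult_nonneg_nonneg simp: power2_eq_square\<close>)
  finally show ?thesis .
qed

section \<open>Sets with proportional exponential integrals\<close>

text \<open>The linear span of the exponentials, which is already an algebra because exponents add.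
  The inductive form lets identities linear in the integrand be proved by rule induction.\<close>

inductive exp_sum :: "('a::euclidean_space \<Rightarrow> real) \<Rightarrow> bool" where
  exp_sum_exp: "exp_sum (\<lambda>x. a * exp (x \<bullet> y))"
| exp_sum_add: "exp_sum f \<Longrightarrow> exp_sum g \<Longrightarrow> exp_sum (\<lambda>x. f x + g x)"

lemma exp_sum_mult:
  assumes "exp_sum f" "exp_sum g"
  shows "exp_sum (\<lambda>x. f x * g x)"
  using assms(1)
proof induction
  case (exp_sum_exp a y)
  from assms(2) show ?case
  proof induction
    case (exp_sum_exp b z)
    have "(\<lambda>x. a * exp (x \<bullet> y) * (b * exp (x \<bullet> z))) = (\<lambda>x. (a * b) * exp (x \<bullet> (y + z)))"
      by (simp add: inner_add_right exp_add mult_ac)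
    then show ?case by (metis exp_sum.exp_sum_exp)
  qed (simp add: distrib_left exp_sum.exp_sum_add)
qed (simp add: distrib_right exp_sum.exp_sum_add)

lemma exp_sum_continuous: "exp_sum f \<Longrightarrow> continuous_on S f"
  by (induction rule: exp_sum.induct) (auto intro!: continuous_intros)

lemma exp_sum_dense:
  fixes K :: "'a::euclidean_space set"
  assumes "compact K" "continuous_on K g" "e > 0"
  shows "\<exists>f. exp_sum f \<and> (\<forall>x\<in>K. \<bar>g x - f x\<bar> < e)"
proof -
  interpret function_ring_on "Collect exp_sum" K
  proof
    show "(\<lambda>_::'a. c) \<in> Collect exp_sum" for c
      using exp_sum_exp[of c "0::'a"] by simp
    fix x y :: 'a assume "x \<noteq> y"
    then have "(x - y) \<bullet> (x - y) \<noteq> 0" by simp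
    then have "x \<bullet> (x - y) \<noteq> y \<bullet> (x - y)" by (simp add: inner_diff_left)
    then have "1 * exp (x \<bullet> (x - y)) \<noteq> 1 * exp (y \<bullet> (x - y))" by simp
    then show "\<exists>f\<in>Collect exp_sum. f x \<noteq> f y"
      using exp_sum_exp[of 1 "x - y"] by (intro bexI[of _ "\<lambda>z. 1 * exp (z \<bullet> (x - y))"] CollectI)
  qed (auto intro: exp_sum_mult exp_sum_add exp_sum_continuous assms(1))
  show ?thesis using Stone_Weierstrass_basic[OF assms(2,3)] by auto
qed

lemma abs_set_integral_le:
  fixes f :: "'a::euclidean_space \<Rightarrow> real"
  assumes S: "S \<in> sets borel" "bounded S" and f: "continuous_on UNIV f" and le: "\<And>x. x \<in> S \<Longrightarrow> \<bar>f x\<bar> \<le> e"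
  shows "\<bar>LINT x:S|lborel. f x\<bar> \<le> e * measure lborel S"
proof -
  have "\<bar>LINT x:S|lborel. f x\<bar> \<le> (LINT x|lborel. \<bar>indicator S x *\<^sub>R f x\<bar>)"
    unfolding set_lebesgue_integral_def by (rule integral_abs_bound)
  also have "\<dots> \<le> (LINT x|lborel. e * indicator S x)"
  proof (rule integral_mono)
    show "integrable lborel (\<lambda>x. \<bar>indicator S x *\<^sub>R f x\<bar>)"
      using set_integrable_continuous_bounded[OF S f] by (simp add: set_integrable_def)
    show "integrable lborel (\<lambda>x. e * indicator S x)"
      using set_integrable_continuous_bounded[OF S, of "\<lambda>_. e"] by (simp add: set_integrable_def mult.commute)
    show "\<bar>indicator S x *\<^sub>R f x\<bar> \<le> e * indicator S x" for x
      using le by (simp add: indicator_def)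
  qed
  also have "\<dots> = e * measure lborel S" using S by simp
  finally show ?thesis .
qed

text \<open>Both sides are integrals against finite measures carried by one compact set
  \<open>K\<close>. They agree on the exponential sums by linearity, and these are uniformly dense
  on \<open>K\<close>.\<close>

lemma integral_eq_of_exp_integral_eq:
  fixes S T :: "'a::euclidean_space set" and \<Phi> :: "'a \<Rightarrow> 'a" and \<kappa> :: real
  assumes S: "S \<in> sets borel" "bounded S" and T: "T \<in> sets borel" "bounded T"
    and \<Phi>: "continuous_on UNIV \<Phi>"
    and exp_eq: "\<And>y. (LINT x:S|lborel. exp (x \<bullet> y)) = \<kappa> * (LINT u:T|lborel. exp (\<Phi> u \<bullet> y))"
    and g: "continuous_on UNIV g"
  shows "(LINT x:S|lborel. g x) = \<kappa> * (LINT u:T|lborel. g (\<Phi> u))"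
proof -
  have comp: "continuous_on UNIV (\<lambda>u. f (\<Phi> u))" if "continuous_on UNIV f" for f :: "'a \<Rightarrow> real"
    using that \<Phi> by (rule continuous_on_compose2) auto
  have exp_sum_eq: "(LINT x:S|lborel. f x) = \<kappa> * (LINT u:T|lborel. f (\<Phi> u))" if "exp_sum f" for f
    using that
  proof induction
    case (exp_sum_exp a y)
    then show ?case by (simp add: exp_eq)
  next
    case (exp_sum_add f g)
    have "set_integrable lborel S f" "set_integrable lborel S g"
      using exp_sum_add by (auto intro!: set_integrable_continuous_bounded S exp_sum_continuous)
    moreover have "set_integrable lborel T (\<lambda>u. f (\<Phi> u))" "set_integrable lborel T (\<lambda>u. g (\<Phi> u))"
      by (auto intro!: set_integrable_continuous_bounded T comp exp_sum_continuous[OF exp_sum_add.hyps(1)]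
        exp_sum_continuous[OF exp_sum_add.hyps(2)])
    ultimately show ?case using exp_sum_add by (simp add: set_integral_add distrib_left)
  qed
  define K where "K = closure S \<union> \<Phi> ` closure T"
  have K: "compact K" unfolding K_def
    using S(2) T(2) \<Phi> by (intro compact_Un compact_continuous_image) (auto intro: continuous_on_subset)
  define d where "d = (LINT x:S|lborel. g x) - \<kappa> * (LINT u:T|lborel. g (\<Phi> u))"
  \<comment> \<open>The total mass of both measures; the summand 1 makes it positive, so that
    \<epsilon> can be divided by it.\<close>
  define C where "C = measure lborel S + \<bar>\<kappa>\<bar> * measure lborel T + 1"
  have C: "C > 0" unfolding C_def by (intro add_nonneg_pos add_nonneg_nonneg mult_nonneg_nonneg) auto
  have le: "\<bar>d\<bar> \<le> e * C" if e: "e > 0" for e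
  proof -
    obtain f where f: "exp_sum f" "\<And>x. x \<in> K \<Longrightarrow> \<bar>g x - f x\<bar> < e"
      using exp_sum_dense[OF K, of g e] g e by (auto intro: continuous_on_subset)
    note fc = exp_sum_continuous[OF f(1), of UNIV]
    have 1: "(LINT x:S|lborel. g x - f x) = (LINT x:S|lborel. g x) - (LINT x:S|lborel. f x)"
      by (intro set_integral_diff set_integrable_continuous_bounded S g fc)
    have 2: "(LINT u:T|lborel. g (\<Phi> u) - f (\<Phi> u)) = (LINT u:T|lborel. g (\<Phi> u)) - (LINT u:T|lborel. f (\<Phi> u))"
      by (intro set_integral_diff set_integrable_continuous_bounded T comp g fc)
    have "d = (LINT x:S|lborel. g x - f x) - \<kappa> * (LINT u:T|lborel. g (\<Phi> u) - f (\<Phi> u))"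
      using exp_sum_eq[OF f(1)] by (simp add: d_def 1 2 right_diff_distrib)
    then have "\<bar>d\<bar> \<le> \<bar>LINT x:S|lborel. g x - f x\<bar> + \<bar>\<kappa>\<bar> * \<bar>LINT u:T|lborel. g (\<Phi> u) - f (\<Phi> u)\<bar>"
      by (simp add: abs_mult[symmetric])
    also have "\<bar>LINT x:S|lborel. g x - f x\<bar> \<le> e * measure lborel S"
      using f(2) closure_subset[of S] by (intro abs_set_integral_le S continuous_intros g fc) (force simp: K_def)
    also have "\<bar>LINT u:T|lborel. g (\<Phi> u) - f (\<Phi> u)\<bar> \<le> e * measure lborel T"
      using f(2) closure_subset[of T] by (intro abs_set_integral_le T continuous_on_diff comp g fc) (force simp: K_def)
    finally have "\<bar>d\<bar> \<le> e * measure lborel S + \<bar>\<kappa>\<bar> * (e * measure lborel T)" by (simp add: mult_left_mono)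
    also have "\<dots> \<le> e * C" using e by (simp add: C_def algebra_simps)
    finally show ?thesis .
  qed
  have "\<bar>d\<bar> \<le> 0"
  proof (rule field_le_epsilon)
    fix \<epsilon> :: real assume "\<epsilon> > 0"
    then show "\<bar>d\<bar> \<le> 0 + \<epsilon>" using le[of "\<epsilon> / C"] C by simp
  qed
  then show ?thesis by (simp add: d_def)
qed

text \<open>The tents \<open>max 0 (r - dist z x)\<close> detect a ball on which only one of the two measures lives.\<close>

lemma smooth_domain_eq_of_integral_eq:
  fixes D :: "'a::euclidean_space set" and \<Phi> :: "'a \<Rightarrow> 'a" and \<kappa> :: real
  assumes D: "bounded_domain D" "C_infinity_boundary D"
    and \<Phi>: "continuous_on UNIV \<Phi>" "inj \<Phi>" "open (\<Phi> ` ball 0 1)"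
    and \<kappa>: "\<kappa> > 0"
    and eq: "\<And>g. continuous_on UNIV g \<Longrightarrow> (LINT x:D|lborel. g x) = \<kappa> * (LINT u:cball 0 1|lborel. g (\<Phi> u))"
  shows "D = \<Phi> ` ball 0 1"
proof -
  have D': "open D" "D \<noteq> {}" "bounded D" "D \<in> sets borel" using D by (auto simp: bounded_domain_def)
  define tent where "tent = (\<lambda>z r (x::'a). max 0 (r - dist z x))"
  have tent: "continuous_on UNIV (tent z r)" "tent z r x \<ge> 0" "x \<notin> ball z r \<Longrightarrow> tent z r x = 0" for z r x
    by (auto simp: tent_def intro!: continuous_intros)
  have tentz: "r > 0 \<Longrightarrow> tent z r z > 0" for z r by (simp add: tent_def)
  have DE: "D \<subseteq> \<Phi> ` cball 0 1"
  proof (rule ccontr)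
    assume "\<not> ?thesis"
    then obtain z where z: "z \<in> D - \<Phi> ` cball 0 1" by blast
    have "closed (\<Phi> ` cball 0 1)"
      using \<Phi>(1) by (intro compact_imp_closed compact_continuous_image) (auto intro: continuous_on_subset)
    then have "open (D - \<Phi> ` cball 0 1)" using D' by (intro open_Diff)
    then obtain r where r: "r > 0" "ball z r \<subseteq> D - \<Phi> ` cball 0 1" using z openE by blast
    have "(LINT x:D|lborel. tent z r x) > 0"
      by (rule set_integral_pos[where U=D and z=z]) (use D' z tent(1,2) tentz[OF r(1), of z] in simp_all)
    moreover have "(LINT u:cball 0 1|lborel. tent z r (\<Phi> u)) = 0"
    proof -
      have "indicator (cball 0 1) u *\<^sub>R tent z r (\<Phi> u) = 0" for u
      proof (cases "u \<in> cball 0 1")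
        case True
        then have "\<Phi> u \<notin> ball z r" using r(2) by blast
        then show ?thesis using tent(3) by simp
      qed simp
      then show ?thesis by (simp only: set_lebesgue_integral_def) simp
    qed
    ultimately show False using eq[OF tent(1), of z r] by simp
  qed
  have no_ball: "W = {}" if W: "open W" "W \<subseteq> \<Phi> ` ball 0 1 - D" for W
  proof (rule ccontr)
    assume "W \<noteq> {}"
    then obtain z where "z \<in> W" by blast
    then obtain r where z: "z \<in> W" "r > 0" "ball z r \<subseteq> W" using openE[OF W(1)] by metis
    have "z \<in> \<Phi> ` ball 0 1" using z(1) W(2) by blast
    then obtain u where u: "u \<in> ball 0 1" "z = \<Phi> u" by blast
    have "(LINT x:D|lborel. tent z r x) = 0"
    proof -
      have "indicator D x *\<^sub>R tent z r x = 0" for x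
      proof (cases "x \<in> D")
        case True
        then have "x \<notin> ball z r" using z(3) W(2) by blast
        then show ?thesis using tent(3) by simp
      qed simp
      then show ?thesis by (simp only: set_lebesgue_integral_def) simp
    qed
    moreover have "(LINT u:cball 0 1|lborel. tent z r (\<Phi> u)) > 0"
    proof (rule set_integral_pos[where U="ball 0 1" and z=u])
      show "continuous_on UNIV (\<lambda>u. tent z r (\<Phi> u))"
        by (rule continuous_on_compose2[OF tent(1) \<Phi>(1)]) simp
      show "0 < tent z r (\<Phi> u)" using tentz[OF z(2), of z] u by simp
    qed (use u tent(2) in simp_all)
    ultimately show False using eq[OF tent(1), of z r] \<kappa> by simp
  qed
  \<comment> \<open>The inclusion in the image of the closed ball improves to the open ball because
    the preimage of the open set \<open>D\<close> lies in the interior.\<close>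
  have sub: "D \<subseteq> \<Phi> ` ball 0 1"
  proof
    fix x assume x: "x \<in> D"
    have "open (\<Phi> -` D)" using \<Phi>(1) D'(1) by (simp add: open_vimage)
    moreover have "\<Phi> -` D \<subseteq> cball 0 1"
    proof
      fix u assume "u \<in> \<Phi> -` D"
      then have "\<Phi> u \<in> \<Phi> ` cball 0 1" using DE by blast
      then show "u \<in> cball 0 1" by (simp only: inj_image_mem_iff[OF \<Phi>(2)])
    qed
    ultimately have "\<Phi> -` D \<subseteq> interior (cball 0 1)" by (rule interior_maximal[rotated])
    then have sub: "\<Phi> -` D \<subseteq> ball 0 1" by (simp only: interior_cball)
    obtain u where u: "x = \<Phi> u" using x DE by blast
    then have "u \<in> ball 0 1" using subsetD[OF sub, of u] x by simp
    then show "x \<in> \<Phi> ` ball 0 1" using u by (rule_tac image_eqI)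
  qed
  show ?thesis
  proof (rule ccontr)
    \<comment> \<open>Equality of integrals alone would allow \<open>D\<close> to omit a null set,
      for instance a slit. If it omits anything, the connected image of the ball contains a frontier
      point \<open>p\<close> of \<open>D\<close>; moving from \<open>p\<close> along a direction in
      which the defining function increases reaches an open part of the image outside
      \<open>D\<close>, contrary to \<open>no_ball\<close>.\<close>
    assume ne: "D \<noteq> \<Phi> ` ball 0 1"
    have "connected (\<Phi> ` ball 0 1)"
      using \<Phi>(1) by (intro connected_continuous_image connected_ball) (auto intro: continuous_on_subset)
    moreover have "\<Phi> ` ball 0 1 \<inter> D \<noteq> {}" "\<Phi> ` ball 0 1 - D \<noteq> {}" using sub ne D'(2) by auto
    ultimately have "\<Phi> ` ball 0 1 \<inter> frontier D \<noteq> {}" by (rule connected_Int_frontier)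
    then obtain p where p: "p \<in> \<Phi> ` ball 0 1" "p \<in> frontier D" by blast
    obtain U \<rho> where U: "open U" "p \<in> U" "C_infinity_on U \<rho>"
      and nz: "\<And>x. x \<in> U \<Longrightarrow> frechet_derivative \<rho> (at x) \<noteq> (\<lambda>_. 0)"
      and DU: "D \<inter> U = {x\<in>U. \<rho> x < 0}"
      using bspec[OF D(2)[unfolded C_infinity_boundary_def] p(2)] by metis
    have "Ck_on (Suc 0) U \<rho>" using U(3) by (simp only: C_infinity_on_def)
    then have diff: "\<rho> differentiable (at x)" if "x \<in> U" for x using that by simp
    then have cont: "continuous_on U \<rho>"
      by (metis U(1) continuous_on_eq_continuous_at differentiable_imp_continuous_within)
    obtain v where v: "frechet_derivative \<rho> (at p) v > 0"
    proof -
      obtain w where w: "frechet_derivative \<rho> (at p) w \<noteq> 0" using nz[OF U(2)] by auto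
      have "frechet_derivative \<rho> (at p) (- w) = - frechet_derivative \<rho> (at p) w"
        using linear_frechet_derivative[OF diff[OF U(2)]] by (rule linear_neg)
      then show ?thesis using w that[of w] that[of "- w"] by linarith
    qed
    have "p \<notin> D" using p(2) D'(1) by (auto simp: frontier_def interior_open)
    then have "p \<notin> {x\<in>U. \<rho> x < 0}" using DU by auto
    then have \<rho>p: "\<rho> p \<ge> 0" using U(2) by simp
    have lin: "linear (frechet_derivative \<rho> (at p))"
      using linear_frechet_derivative[OF diff[OF U(2)]] .
    have "((\<lambda>t. \<rho> (p + t *\<^sub>R v)) has_real_derivative frechet_derivative \<rho> (at p) v) (at 0)"
    proof -
      have "((\<lambda>t. \<rho> (p + t *\<^sub>R v)) has_derivative (\<lambda>t. frechet_derivative \<rho> (at p) (t *\<^sub>R v))) (at 0)"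
        using diff[OF U(2)] unfolding frechet_derivative_works
        by (intro has_derivative_compose[of "\<lambda>t. p + t *\<^sub>R v", where g=\<rho>, simplified])
          (auto intro!: derivative_eq_intros)
      then show ?thesis
        by (simp add: has_field_derivative_def linear_cmul[OF lin] mult.commute[of _ "frechet_derivative \<rho> (at p) v"])
    qed
    then obtain s where s: "s > 0" "\<And>t. 0 < t \<Longrightarrow> t < s \<Longrightarrow> \<rho> p < \<rho> (p + t *\<^sub>R v)"
      using DERIV_pos_inc_right[of "\<lambda>t. \<rho> (p + t *\<^sub>R v)" "frechet_derivative \<rho> (at p) v" 0] v by auto
    have "open ((\<lambda>t. p + t *\<^sub>R v) -` (U \<inter> \<Phi> ` ball 0 1))"
      by (intro open_vimage open_Int U \<Phi> continuous_intros)
    moreover have "0 \<in> (\<lambda>t. p + t *\<^sub>R v) -` (U \<inter> \<Phi> ` ball 0 1)" using U p by simp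
    ultimately obtain s' where s': "s' > 0" "ball 0 s' \<subseteq> (\<lambda>t. p + t *\<^sub>R v) -` (U \<inter> \<Phi> ` ball 0 1)"
      using openE by blast
    define t where "t = min s s' / 2"
    have t: "0 < t" "t < s" "t \<in> ball 0 s'" using s s' by (auto simp: t_def)
    have "p + t *\<^sub>R v \<in> U \<inter> \<Phi> ` ball 0 1" using subsetD[OF s'(2) t(3)] by simp
    moreover have "\<rho> (p + t *\<^sub>R v) > 0" using s(2)[OF t(1,2)] \<rho>p by simp
    ultimately have "p + t *\<^sub>R v \<in> (U \<inter> \<rho> -` {0<..}) \<inter> \<Phi> ` ball 0 1" by simp
    moreover have "open ((U \<inter> \<rho> -` {0<..}) \<inter> \<Phi> ` ball 0 1)"
      using continuous_open_preimage[OF cont U(1), of "{0<..}"] \<Phi>(3) by (intro open_Int[OF _ \<Phi>(3)]) auto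
    moreover have "(U \<inter> \<rho> -` {0<..}) \<inter> \<Phi> ` ball 0 1 \<subseteq> \<Phi> ` ball 0 1 - D"
    proof
      fix x assume x: "x \<in> (U \<inter> \<rho> -` {0<..}) \<inter> \<Phi> ` ball 0 1"
      then have "x \<notin> {x\<in>U. \<rho> x < 0}" by simp
      then have "x \<notin> D" using x unfolding DU[symmetric] by simp
      then show "x \<in> \<Phi> ` ball 0 1 - D" using x by simp
    qed
    ultimately show False using no_ball by (metis empty_iff)
  qed
qed

section \<open>Ellipsoids\<close>

text \<open>The slab formula is applied to three kinds of test functions: the identity gives the
  centres, a centred square gives the half-widths as the norm attached to the covariance form of
  \<open>D\<close>, and exponentials give the conclusion once both are known.\<close>

lemma (in bounded_nonempty) quadratic_support_imp_exp_integral: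
  assumes D: "open D"
    and slab: "\<And>g y. continuous_on UNIV g \<Longrightarrow> 1/2 < norm y \<Longrightarrow> norm y < 1 \<Longrightarrow>
      (LINT x:D|lborel. g (x \<bullet> y)) * bump_integral m (\<lambda>_. 1)
      = measure lborel D * bump_integral m (\<lambda>\<tau>. g (slab_center y + slab_radius y * \<tau>))"
  obtains S :: "'a \<Rightarrow> 'a" and c \<kappa> where "linear S" "bij S" "\<kappa> > 0"
    "\<And>y. (LINT x:D|lborel. exp (x \<bullet> y)) = \<kappa> * exp (c \<bullet> y) * bump_integral m (\<lambda>\<tau>. exp (norm (S y) * \<tau>))"
proof -
  have Dm: "D \<in> sets borel" using D by simp
  define V where "V = measure lborel D"
  define \<beta> where "\<beta> = bump_integral m (\<lambda>_. 1)"
  define \<beta>2 where "\<beta>2 = bump_integral m (\<lambda>\<tau>. \<tau>\<^sup>2)"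
  have \<beta>: "\<beta> > 0" unfolding \<beta>_def by (rule bump_integral_pos) auto
  have \<beta>2: "\<beta>2 > 0" unfolding \<beta>2_def by (rule bump_integral_pos) (auto intro!: continuous_intros)
  obtain z0 where z0: "z0 \<in> D" using nonempty_D by blast
  have V: "V > 0"
    using set_integral_pos[of D "\<lambda>_. 1" D z0] Dm bounded_D D z0 by (simp add: V_def set_lebesgue_integral_def)
  have int: "set_integrable lborel D f" if "continuous_on UNIV f" for f :: "'a \<Rightarrow> 'b::euclidean_space"
    using Dm bounded_D that by (rule set_integrable_continuous_bounded)
  \<comment> \<open>The centroid of \<open>D\<close>.\<close>
  define c where "c = (1 / V) *\<^sub>R (LINT x:D|lborel. x)"
  have mean: "(LINT x:D|lborel. x \<bullet> y) = V * (c \<bullet> y)" for y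
  proof -
    have "(LINT x:D|lborel. x \<bullet> y) = (LINT x|lborel. (indicator D x *\<^sub>R x) \<bullet> y)"
      by (simp add: set_lebesgue_integral_def)
    also have "\<dots> = (LINT x:D|lborel. x) \<bullet> y"
      unfolding set_lebesgue_integral_def using int[OF continuous_on_id]
      by (intro integral_inner_left) (simp add: set_integrable_def)
    finally show ?thesis using V by (simp add: c_def)
  qed
  \<comment> \<open>The test function is the identity; the term with \<open>slab_radius\<close>
    drops out because the weight is even.\<close>
  have center: "slab_center y = c \<bullet> y" if y: "1/2 < norm y" "norm y < 1" for y
  proof -
    have "V * (c \<bullet> y) * \<beta> = V * bump_integral m (\<lambda>\<tau>. slab_center y * 1 + slab_radius y * \<tau>)"
      using slab[OF continuous_on_id y] by (simp add: mean V_def \<beta>_def)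
    also have "bump_integral m (\<lambda>\<tau>. slab_center y * 1 + slab_radius y * \<tau>) = slab_center y * \<beta>"
    proof -
      have "bump_integral m (\<lambda>\<tau>. slab_center y * 1 + slab_radius y * \<tau>)
          = bump_integral m (\<lambda>\<tau>. slab_center y * 1) + bump_integral m (\<lambda>\<tau>. slab_radius y * \<tau>)"
        by (rule bump_integral_add) (intro continuous_intros)+
      then show ?thesis by (simp only: bump_integral_cmult bump_integral_odd \<beta>_def)
    qed
    finally show ?thesis using V \<beta> by simp
  qed
  \<comment> \<open>Chosen so that \<open>b y y\<close> is the squared half-width: the second moment
    of \<open>D\<close> about its centroid in direction \<open>y\<close>, times \<beta>, equals
    \<open>V * \<beta>2\<close> times that square.\<close>
  define k where "k = \<beta> / (V * \<beta>2)"
  have k: "k > 0" using \<beta> \<beta>2 V by (simp add: k_def)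
  define b where "b = (\<lambda>y z. k * (LINT x:D|lborel. ((x - c) \<bullet> y) * ((x - c) \<bullet> z)))"
  have radius: "(slab_radius y)\<^sup>2 = b y y" if y: "1/2 < norm y" "norm y < 1" for y
  proof -
    have "(LINT x:D|lborel. (x \<bullet> y - c \<bullet> y)\<^sup>2) * \<beta>
        = V * bump_integral m (\<lambda>\<tau>. (slab_center y + slab_radius y * \<tau> - c \<bullet> y)\<^sup>2)"
      unfolding V_def \<beta>_def by (rule slab[OF _ y]) (intro continuous_intros)
    also have "(\<lambda>\<tau>. (slab_center y + slab_radius y * \<tau> - c \<bullet> y)\<^sup>2) = (\<lambda>\<tau>. (slab_radius y)\<^sup>2 * \<tau>\<^sup>2)"
      by (simp add: center[OF y] power_mult_distrib)
    also have "bump_integral m \<dots> = (slab_radius y)\<^sup>2 * \<beta>2"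
      by (simp add: bump_integral_cmult \<beta>2_def)
    also have "(LINT x:D|lborel. (x \<bullet> y - c \<bullet> y)\<^sup>2) = b y y / k"
      using k by (simp add: b_def inner_diff_left power2_eq_square)
    finally show ?thesis using V \<beta> \<beta>2 by (simp add: k_def field_simps)
  qed
  have radius_pos: "slab_radius y > 0" if "y \<noteq> 0" for y
    using inner_less_support[OF D z0, of y] inner_less_support[OF D z0, of "- y"] that by (simp add: slab_radius_def)
  have lin: "linear (\<lambda>y. b y z)" for z
  proof (rule linearI)
    show "b (y + y') z = b y z + b y' z" for y y'
      unfolding b_def inner_add_right distrib_right distrib_left[symmetric]
      by (subst set_integral_add) (auto intro!: int continuous_intros simp: distrib_left)
    show "b (r *\<^sub>R y) z = r *\<^sub>R b y z" for r y
      by (simp add: b_def mult.assoc)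
  qed
  have sym: "b y z = b z y" for y z
    by (simp add: b_def mult.commute)
  \<comment> \<open>Any nonzero vector is rescaled to length 3/4, which lies inside the
    annulus.\<close>
  have scale_annulus: "\<exists>r u. r > 0 \<and> 1/2 < norm u \<and> norm u < 1 \<and> y = r *\<^sub>R u" if "y \<noteq> 0" for y :: 'a
    using that by (intro exI[of _ "4 / 3 * norm y"] exI[of _ "(3 / 4 / norm y) *\<^sub>R y"]) auto
  have pos: "b y y > 0" if y: "y \<noteq> 0" for y
  proof -
    obtain r u where ru: "r > 0" "1/2 < norm u" "norm u < 1" "y = r *\<^sub>R u" using scale_annulus[OF y] by blast
    have "b y y = r * b u (r *\<^sub>R u)" using linear_cmul[OF lin[of "r *\<^sub>R u"], of r u] ru by simp
    also have "b u (r *\<^sub>R u) = r * b u u" using linear_cmul[OF lin[of u], of r u] sym by simp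
    finally have "b y y = r * (r * (slab_radius u)\<^sup>2)" using radius ru by simp
    moreover have "slab_radius u \<noteq> 0" using radius_pos[of u] ru(2) by (cases "u = 0") auto
    ultimately show ?thesis using ru by simp
  qed
  obtain T :: "'a \<Rightarrow> 'a" where T: "linear T" "bij T" "\<And>u. b (T u) (T u) = (norm u)\<^sup>2"
    using positive_definite_form_isometric[of b, OF lin sym pos] by blast
  \<comment> \<open>In the coordinates given by \<open>inv T\<close> the form \<open>b\<close> is
    the squared Euclidean norm, so the half-width becomes \<open>norm (S y)\<close>.\<close>
  define S where "S = inv T"
  have S: "linear S" "bij S"
    unfolding S_def using inj_linear_imp_inv_linear[OF T(1) bij_is_inj[OF T(2)]] bij_imp_bij_inv[OF T(2)] by auto
  have TS: "T (S y) = y" for y using T(2) by (simp add: S_def bij_def surj_f_inv_f)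
  have radius_S: "slab_radius y = norm (S y)" if y: "1/2 < norm y" "norm y < 1" for y
  proof -
    have "(slab_radius y)\<^sup>2 = (norm (S y))\<^sup>2" using radius[OF y] T(3)[of "S y"] by (simp add: TS)
    moreover have "slab_radius y > 0" using radius_pos[of y] y(1) by (cases "y = 0") auto
    ultimately show ?thesis by (simp add: power2_eq_iff_nonneg)
  qed
  have exp_eq: "(LINT x:D|lborel. exp (x \<bullet> y)) = V / \<beta> * exp (c \<bullet> y) * bump_integral m (\<lambda>\<tau>. exp (norm (S y) * \<tau>))" for y
  proof -
    \<comment> \<open>The dilation is absorbed by the test function \<open>exp (r * t)\<close> at
      the annulus vector \<open>u\<close>; \<open>r = 0\<close> covers \<open>y = 0\<close>.\<close>
    obtain r u where ru: "r \<ge> 0" "1/2 < norm u" "norm u < 1" "y = r *\<^sub>R u"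
    proof (cases "y = 0")
      case True
      obtain i :: 'a where "i \<in> Basis" using nonempty_Basis by blast
      then show ?thesis using that[of 0 "(3/4) *\<^sub>R i"] True by simp
    next
      case False
      then show ?thesis using scale_annulus[OF False] that by (metis less_imp_le)
    qed
    have "(LINT x:D|lborel. exp (r * (x \<bullet> u))) * \<beta> = V * bump_integral m (\<lambda>\<tau>. exp (r * (slab_center u + slab_radius u * \<tau>)))"
      unfolding V_def \<beta>_def by (rule slab[OF _ ru(2,3)]) (intro continuous_intros)
    also have "(\<lambda>\<tau>. exp (r * (slab_center u + slab_radius u * \<tau>))) = (\<lambda>\<tau>. exp (c \<bullet> y) * exp (norm (S y) * \<tau>))"
      using ru by (simp add: center radius_S linear_cmul[OF S(1)] exp_add[symmetric] algebra_simps)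
    finally show ?thesis using \<beta> ru(4) by (simp add: bump_integral_cmult field_simps)
  qed
  show thesis
    by (rule that[OF S _ exp_eq]) (use V \<beta> in simp)
qed

text \<open>\<open>norm (S y)\<close> is the support function of the image of the unit ball under
  the adjoint of \<open>S\<close>. Since \<open>L u . y = u . S y\<close>, the model formula at
  \<open>S y\<close> yields the same bump integral as for \<open>D\<close>, so \<open>D\<close> and
  the translate of this image by \<open>c\<close> have exponential integrals in the fixed ratio
  \<mu>.\<close>

lemma (in bounded_nonempty) ellipsoid_of_slab_formula:
  assumes D: "bounded_domain D" "C_infinity_boundary D" and dim: "DIM('a) = 2 * m + 1"
    and slab: "\<And>g y. continuous_on UNIV g \<Longrightarrow> 1/2 < norm y \<Longrightarrow> norm y < 1 \<Longrightarrow>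
      (LINT x:D|lborel. g (x \<bullet> y)) * bump_integral m (\<lambda>_. 1)
      = measure lborel D * bump_integral m (\<lambda>\<tau>. g (slab_center y + slab_radius y * \<tau>))"
  shows "ellipsoid D"
proof -
  have D': "open D" "bounded D" "D \<in> sets borel" using D(1) by (auto simp: bounded_domain_def)
  obtain S :: "'a \<Rightarrow> 'a" and c \<kappa> where S: "linear S" "bij S" and \<kappa>: "\<kappa> > 0"
    and exp_eq: "\<And>y. (LINT x:D|lborel. exp (x \<bullet> y)) = \<kappa> * exp (c \<bullet> y) * bump_integral m (\<lambda>\<tau>. exp (norm (S y) * \<tau>))"
  proof (rule quadratic_support_imp_exp_integral[OF D'(1)])
    fix S :: "'a \<Rightarrow> 'a" and c \<kappa>
    assume "linear S" "bij S" "\<kappa> > 0"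
      "\<And>y. (LINT x:D|lborel. exp (x \<bullet> y)) = \<kappa> * exp (c \<bullet> y) * bump_integral m (\<lambda>\<tau>. exp (norm (S y) * \<tau>))"
    then show thesis by (rule that)
  qed (rule slab)
  define L where "L = adjoint S"
  have L: "linear L" "bij L"
    using S by (auto simp: L_def adjoint_linear bij_def)
  define \<Phi> where "\<Phi> = (\<lambda>u. L u + c)"
  have \<Phi>: "continuous_on UNIV \<Phi>"
    unfolding \<Phi>_def by (intro continuous_intros linear_continuous_on L(1)[THEN linear_conv_bounded_linear[THEN iffD1]])
  define v where "v = unit_ball_vol (real (2 * m))"
  have v: "v > 0" unfolding v_def by (rule unit_ball_vol_pos) simp
  define \<mu> where "\<mu> = \<kappa> / v"
  have \<Phi>_exp: "(LINT x:D|lborel. exp (x \<bullet> y)) = \<mu> * (LINT u:cball 0 1|lborel. exp (\<Phi> u \<bullet> y))" for y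
  proof -
    have "exp (\<Phi> u \<bullet> y) = exp (c \<bullet> y) * exp (u \<bullet> S y)" for u
    proof -
      have "L u \<bullet> y = u \<bullet> S y"
        using adjoint_works[OF S(1), of y u] by (metis L_def inner_commute)
      then have "\<Phi> u \<bullet> y = c \<bullet> y + u \<bullet> S y"
        by (simp add: \<Phi>_def inner_add_left)
      then show ?thesis by (simp add: exp_add)
    qed
    then have "(LINT u:cball 0 1|lborel. exp (\<Phi> u \<bullet> y)) = exp (c \<bullet> y) * (LINT u:cball 0 1|lborel. exp (u \<bullet> S y))"
      by simp
    also have "\<dots> = exp (c \<bullet> y) * (v * bump_integral m (\<lambda>\<tau>. exp (norm (S y) * \<tau>)))"
      by (subst integral_cball_inner[OF dim, folded v_def]) auto
    finally show ?thesis using v by (simp add: exp_eq \<mu>_def)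
  qed
  have integral_eq: "(LINT x:D|lborel. g x) = \<mu> * (LINT u:cball 0 1|lborel. g (\<Phi> u))" if "continuous_on UNIV g" for g
    by (rule integral_eq_of_exp_integral_eq[OF D'(3,2) _ _ \<Phi> \<Phi>_exp that]) auto
  have inj: "inj \<Phi>" using L(2) by (auto simp: \<Phi>_def inj_on_def bij_def)
  have opn: "open (\<Phi> ` ball 0 1)"
  proof -
    have "open (L ` ball 0 1)" using L by (intro open_surjective_linear_image) (auto simp: bij_def)
    then have "open ((\<lambda>x. c + x) ` L ` ball 0 1)" by (rule open_translation)
    then show ?thesis by (simp add: \<Phi>_def image_image add.commute)
  qed
  have "\<mu> > 0" using \<kappa> v by (simp add: \<mu>_def)
  have "D = \<Phi> ` ball 0 1"
    by (rule smooth_domain_eq_of_integral_eq[OF D \<Phi> inj opn \<open>\<mu> > 0\<close> integral_eq])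
  then show ?thesis
    unfolding ellipsoid_def using L \<Phi>_def by blast
qed

section \<open>Assembly: from almost all directions to the ellipsoid\<close>

theorem theorem8:
  fixes D :: "(real ^ 'n) set"
  assumes "odd CARD('n)"
    and "bounded_domain D"
    and "C_infinity_boundary D"
    and "AE \<omega> in sphere_measure. \<exists>P :: real poly. degree P \<le> CARD('n) - 1 \<and>
           (\<forall>t. hyperplane \<omega> t \<inter> D \<noteq> {} \<longrightarrow> section_volume D \<omega> t = poly P t)"
  shows "ellipsoid D"
proof -
  have D: "open D" "connected D" "bounded D" "D \<noteq> {}"
    using assms(2) by (auto simp: bounded_domain_def)
  interpret bounded_nonempty D by standard (use D in auto)
  obtain m where m: "CARD('n) = 2 * m + 1" using assms(1) by (auto elim: oddE)
  have dim: "DIM(real ^ 'n) = 2 * m + 1" using m by simp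
  obtain R where R: "R > 0" "\<And>x. x \<in> D \<Longrightarrow> \<exists>c. x \<in> ball c R \<and> ball c R \<subseteq> D"
    using uniform_interior_ball[OF assms(2,3)] by blast
  have caps: "AE y in lborel. 1/2 < norm y \<and> norm y < 1 \<longrightarrow>
    liminf (\<lambda>k. ennreal (real (Suc k) ^ m) * emeasure lborel {x \<in> D. H y - 1 / real (Suc k) < x \<bullet> y}) = 0"
    by (rule AE_liminf_cap_volume[OF D(1) R(1) _ dim]) (rule R(2))
  let ?A = "ball 0 1 - cball 0 (1/2) :: (real ^ 'n) set"
  have slab: "AE y in lborel. y \<in> ?A \<longrightarrow> (LINT x:D|lborel. g (x \<bullet> y)) * bump_integral m (\<lambda>_. 1)
      = measure lborel D * bump_integral m (\<lambda>\<tau>. g (slab_center y + slab_radius y * \<tau>))"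
    if g: "continuous_on UNIV g" for g
    \<comment> \<open>Three null sets of vectors are discarded: those whose direction lacks a
      section polynomial, and those whose caps at the upper or at the lower end are not small
      enough.\<close>
    using AE_sphere_measure_imp_AE_lborel[OF assms(4)] caps AE_lborel_uminus[OF caps]
  proof eventually_elim
    case (elim y)
    show ?case
    proof
      assume y: "y \<in> ?A"
      then have y0: "y \<noteq> 0" "1/2 < norm y \<and> norm y < 1" by auto
      then obtain P :: "real poly" where "degree P \<le> CARD('n) - 1"
        "\<forall>t. hyperplane (y /\<^sub>R norm y) t \<inter> D \<noteq> {} \<longrightarrow> section_volume D (y /\<^sub>R norm y) t = poly P t"
        using elim(1) by auto
      then show "(LINT x:D|lborel. g (x \<bullet> y)) * bump_integral m (\<lambda>_. 1)
        = measure lborel D * bump_integral m (\<lambda>\<tau>. g (slab_center y + slab_radius y * \<tau>))"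
        using elim(2,3) y0 m g
        by (intro slab_formula[OF D(1,2) y0(1), of P] borel_measurable_continuous_onI) auto
    qed
  qed
  show ?thesis
  proof (rule ellipsoid_of_slab_formula[OF assms(2,3) dim])
    fix g :: "real \<Rightarrow> real" and y :: "real ^ 'n"
    assume g: "continuous_on UNIV g" and y: "1/2 < norm y" "norm y < 1"
    show "(LINT x:D|lborel. g (x \<bullet> y)) * bump_integral m (\<lambda>_. 1)
      = measure lborel D * bump_integral m (\<lambda>\<tau>. g (slab_center y + slab_radius y * \<tau>))"
      \<comment> \<open>The open annulus lets continuity in \<open>y\<close> remove the exceptional
        null set.\<close>
      using y by (intro slab_formula_extend[OF D(1) _ _ _ g slab[OF g]]) (auto simp: bounded_diff)
  qed
qed

end
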